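(* Let $X$ be a shift space, let $Y$ be a shift of finite type, and let $\phi:X\to Y$ be a finite-to-one factor code. Suppose that either every proper subsystem $Z$ of $X$ satisfies $h(Z)<h(X)$, or $\phi$ is irreducible. If $\phi$ is bi-continuing a.e. with a bi-retract, then $\phi$ is bi-continuing (everywhere) with a bi-retract.
   Context: Shift spaces are closed (hence compact) shift-invariant subsets of full shifts over finite alphabets; a subsystem of $X$ is a shift space contained in $X$; $h$ denotes topological entropy, $h(X)=\lim_{n}\frac1n\log|\mathcal B_n(X)|$ with $\mathcal B_n(X)$ the set of words of length $n$ occurring in $X$. A code is a sliding block code (continuous shift-commuting map); a factor code is an onto code; it is finite-to-one if every point has finitely many preimages. A map $\phi:X\to Y$ is irreducible if the only closed $A\subseteq X$ with $\phi(A)=\phi(X)$ is $A=X$. A point $x\in X$ is left transitive (resp. right transitive) if every block occurring in $X$ appears in $x$ infinitely often to the left (resp. to the right). Two points are left asymptotic (resp. right asymptotic) if their coordinates agree on some $(-\infty,N]$ (resp. $[N,\infty)$). A code $\phi:X\to Y$ is right-continuing (resp. right-continuing a.e.) if whenever $x\in X$ (resp. $x\in X$ is left transitive), $y\in Y$, and $\phi(x)$ is left asymptotic to $y$, there is $\overline x\in X$ left asymptotic to $x$ with $\phi(\overline x)=y$. An integer $n\ge0$ is a right-continuing retract (resp. right-continuing a.e. retract) of $\phi$ if whenever $x\in X$ (resp. $x\in X$ is left transitive), $y\in Y$ and $\phi(x)_{(-\infty,0]}=y_{(-\infty,0]}$, there is $\overline x\in X$ with $\phi(\overline x)=y$ and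 $\overline x_{(-\infty,-n]}=x_{(-\infty,-n]}$. The left versions are defined symmetrically (with right transitive points and right asymptoticity). Bi-continuing (resp. bi-continuing a.e.) means both left- and right-continuing (resp. a.e.); "with a bi-retract" means that some integer $n\ge 0$ is both a right and a left retract of the corresponding type.
   Formalization: In the case where φ is irreducible, the shift of finite type Y is additionally assumed to be irreducible; otherwise X has no left or right transitive points, the a.e. hypotheses are vacuous, and the claim can fail. *)

theory Defs
  imports "HOL-Analysis.Analysis"
begin

text \<open>
  Points of shift spaces are functions \<open>int \<Rightarrow> 'a\<close>. The alphabet is an arbitrary finite set of
  elements of \<open>'a\<close>. The topology below is the product topology over the discrete space \<open>'a\<close>; on
  the sequences over a finite alphabet it induces the usual product topology of that alphabet.
\<close>

definition config_topology :: "(int \<Rightarrow> 'a) topology" where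
  "config_topology = product_topology (\<lambda>_. discrete_topology UNIV) UNIV"

abbreviation top_of_shift :: "(int \<Rightarrow> 'a) set \<Rightarrow> (int \<Rightarrow> 'a) topology" where
  "top_of_shift X \<equiv> subtopology config_topology X"

definition shift :: "(int \<Rightarrow> 'a) \<Rightarrow> (int \<Rightarrow> 'a)" where
  "shift x = (\<lambda>i. x (i + 1))"

definition shift_space :: "(int \<Rightarrow> 'a) set \<Rightarrow> bool" where
  "shift_space X \<longleftrightarrow>
     (\<exists>A. finite A \<and> (\<forall>x\<in>X. range x \<subseteq> A)) \<and> closedin config_topology X \<and> shift ` X = X"

definition subsystem :: "(int \<Rightarrow> 'a) set \<Rightarrow> (int \<Rightarrow> 'a) set \<Rightarrow> bool" where
  "subsystem Z X \<longleftrightarrow> shift_space Z \<and> Z \<subseteq> X"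

definition word_at :: "(int \<Rightarrow> 'a) \<Rightarrow> int \<Rightarrow> nat \<Rightarrow> 'a list" where
  "word_at x i n = map (\<lambda>k. x (i + int k)) [0..<n]"

definition occurs_at :: "'a list \<Rightarrow> (int \<Rightarrow> 'a) \<Rightarrow> int \<Rightarrow> bool" where
  "occurs_at w x i \<longleftrightarrow> word_at x i (length w) = w"

definition language :: "(int \<Rightarrow> 'a) set \<Rightarrow> 'a list set" where
  "language X = {w. \<exists>x\<in>X. \<exists>i. occurs_at w x i}"

definition blocks :: "nat \<Rightarrow> (int \<Rightarrow> 'a) set \<Rightarrow> 'a list set" where
  "blocks n X = {w \<in> language X. length w = n}"

text \<open>
  The empty shift has no blocks, so its entropy is \<open>log 0 = -\<infinity>\<close>; it has to be treated
  separately because \<open>ln 0 = 0\<close> in HOL.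
\<close>

definition entropy :: "(int \<Rightarrow> 'a) set \<Rightarrow> ereal" where
  "entropy X =
     (if X = {} then -\<infinity> else lim (\<lambda>n. ereal (ln (real (card (blocks n X))) / real n)))"

definition shift_of_finite_type :: "(int \<Rightarrow> 'a) set \<Rightarrow> bool" where
  "shift_of_finite_type Y \<longleftrightarrow>
     (\<exists>A F. finite A \<and> finite F \<and>
        Y = {y. range y \<subseteq> A \<and> (\<forall>w\<in>F. \<forall>i. \<not> occurs_at w y i)})"

text \<open>
  Required of the range of an irreducible map: if the range is reducible, the domain has no left or
  right transitive points, the a.e. conditions below are vacuous, and the everywhere conditions can
  fail.
\<close>

definition irreducible_shift :: "(int \<Rightarrow> 'a) set \<Rightarrow> bool" where
  "irreducible_shift Y \<longleftrightarrow>
     (\<forall>u\<in>language Y. \<forall>v\<in>language Y. \<exists>w. u @ w @ v \<in> language Y)"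

definition code ::
  "(int \<Rightarrow> 'a) set \<Rightarrow> (int \<Rightarrow> 'b) set \<Rightarrow> ((int \<Rightarrow> 'a) \<Rightarrow> (int \<Rightarrow> 'b)) \<Rightarrow> bool" where
  "code X Y \<phi> \<longleftrightarrow>
     continuous_map (top_of_shift X) (top_of_shift Y) \<phi> \<and> (\<forall>x\<in>X. \<phi> (shift x) = shift (\<phi> x))"

definition factor_code ::
  "(int \<Rightarrow> 'a) set \<Rightarrow> (int \<Rightarrow> 'b) set \<Rightarrow> ((int \<Rightarrow> 'a) \<Rightarrow> (int \<Rightarrow> 'b)) \<Rightarrow> bool" where
  "factor_code X Y \<phi> \<longleftrightarrow> code X Y \<phi> \<and> \<phi> ` X = Y"

definition finite_to_one ::
  "(int \<Rightarrow> 'a) set \<Rightarrow> (int \<Rightarrow> 'b) set \<Rightarrow> ((int \<Rightarrow> 'a) \<Rightarrow> (int \<Rightarrow> 'b)) \<Rightarrow> bool" where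
  "finite_to_one X Y \<phi> \<longleftrightarrow> (\<forall>y\<in>Y. finite {x \<in> X. \<phi> x = y})"

definition irreducible_map ::
  "(int \<Rightarrow> 'a) set \<Rightarrow> ((int \<Rightarrow> 'a) \<Rightarrow> (int \<Rightarrow> 'b)) \<Rightarrow> bool" where
  "irreducible_map X \<phi> \<longleftrightarrow>
     (\<forall>A. closedin (top_of_shift X) A \<and> \<phi> ` A = \<phi> ` X \<longrightarrow> A = X)"

definition left_transitive :: "(int \<Rightarrow> 'a) set \<Rightarrow> (int \<Rightarrow> 'a) \<Rightarrow> bool" where
  "left_transitive X x \<longleftrightarrow> x \<in> X \<and> (\<forall>w\<in>language X. infinite {i. i \<le> 0 \<and> occurs_at w x i})"

definition right_transitive :: "(int \<Rightarrow> 'a) set \<Rightarrow> (int \<Rightarrow> 'a) \<Rightarrow> bool" where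
  "right_transitive X x \<longleftrightarrow> x \<in> X \<and> (\<forall>w\<in>language X. infinite {i. i \<ge> 0 \<and> occurs_at w x i})"

definition left_asymptotic :: "(int \<Rightarrow> 'a) \<Rightarrow> (int \<Rightarrow> 'a) \<Rightarrow> bool" where
  "left_asymptotic x y \<longleftrightarrow> (\<exists>N. \<forall>i\<le>N. x i = y i)"

definition right_asymptotic :: "(int \<Rightarrow> 'a) \<Rightarrow> (int \<Rightarrow> 'a) \<Rightarrow> bool" where
  "right_asymptotic x y \<longleftrightarrow> (\<exists>N. \<forall>i\<ge>N. x i = y i)"

text \<open>
  The set \<open>S\<close> collects the points at which the condition is imposed: all of \<open>X\<close> for the
  everywhere notions, and the left (right) transitive points of \<open>X\<close> for the a.e. notions.
\<close>

definition right_continuing_on ::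
  "(int \<Rightarrow> 'a) set \<Rightarrow> (int \<Rightarrow> 'a) set \<Rightarrow> (int \<Rightarrow> 'b) set \<Rightarrow> ((int \<Rightarrow> 'a) \<Rightarrow> (int \<Rightarrow> 'b)) \<Rightarrow> bool" where
  "right_continuing_on S X Y \<phi> \<longleftrightarrow>
     (\<forall>x\<in>S. \<forall>y\<in>Y. left_asymptotic (\<phi> x) y \<longrightarrow>
        (\<exists>x'\<in>X. left_asymptotic x' x \<and> \<phi> x' = y))"

definition left_continuing_on ::
  "(int \<Rightarrow> 'a) set \<Rightarrow> (int \<Rightarrow> 'a) set \<Rightarrow> (int \<Rightarrow> 'b) set \<Rightarrow> ((int \<Rightarrow> 'a) \<Rightarrow> (int \<Rightarrow> 'b)) \<Rightarrow> bool" where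
  "left_continuing_on S X Y \<phi> \<longleftrightarrow>
     (\<forall>x\<in>S. \<forall>y\<in>Y. right_asymptotic (\<phi> x) y \<longrightarrow>
        (\<exists>x'\<in>X. right_asymptotic x' x \<and> \<phi> x' = y))"

definition right_retract_on ::
  "(int \<Rightarrow> 'a) set \<Rightarrow> (int \<Rightarrow> 'a) set \<Rightarrow> (int \<Rightarrow> 'b) set \<Rightarrow> ((int \<Rightarrow> 'a) \<Rightarrow> (int \<Rightarrow> 'b)) \<Rightarrow> nat \<Rightarrow> bool" where
  "right_retract_on S X Y \<phi> n \<longleftrightarrow>
     (\<forall>x\<in>S. \<forall>y\<in>Y. (\<forall>i\<le>0. \<phi> x i = y i) \<longrightarrow>
        (\<exists>x'\<in>X. \<phi> x' = y \<and> (\<forall>i\<le>- int n. x' i = x i)))"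

definition left_retract_on ::
  "(int \<Rightarrow> 'a) set \<Rightarrow> (int \<Rightarrow> 'a) set \<Rightarrow> (int \<Rightarrow> 'b) set \<Rightarrow> ((int \<Rightarrow> 'a) \<Rightarrow> (int \<Rightarrow> 'b)) \<Rightarrow> nat \<Rightarrow> bool" where
  "left_retract_on S X Y \<phi> n \<longleftrightarrow>
     (\<forall>x\<in>S. \<forall>y\<in>Y. (\<forall>i\<ge>0. \<phi> x i = y i) \<longrightarrow>
        (\<exists>x'\<in>X. \<phi> x' = y \<and> (\<forall>i\<ge>int n. x' i = x i)))"

definition bi_continuing ::
  "(int \<Rightarrow> 'a) set \<Rightarrow> (int \<Rightarrow> 'b) set \<Rightarrow> ((int \<Rightarrow> 'a) \<Rightarrow> (int \<Rightarrow> 'b)) \<Rightarrow> bool" where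
  "bi_continuing X Y \<phi> \<longleftrightarrow> right_continuing_on X X Y \<phi> \<and> left_continuing_on X X Y \<phi>"

definition bi_continuing_ae ::
  "(int \<Rightarrow> 'a) set \<Rightarrow> (int \<Rightarrow> 'b) set \<Rightarrow> ((int \<Rightarrow> 'a) \<Rightarrow> (int \<Rightarrow> 'b)) \<Rightarrow> bool" where
  "bi_continuing_ae X Y \<phi> \<longleftrightarrow>
     right_continuing_on {x. left_transitive X x} X Y \<phi> \<and>
     left_continuing_on {x. right_transitive X x} X Y \<phi>"

definition bi_retract ::
  "(int \<Rightarrow> 'a) set \<Rightarrow> (int \<Rightarrow> 'b) set \<Rightarrow> ((int \<Rightarrow> 'a) \<Rightarrow> (int \<Rightarrow> 'b)) \<Rightarrow> nat \<Rightarrow> bool" where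
  "bi_retract X Y \<phi> n \<longleftrightarrow> right_retract_on X X Y \<phi> n \<and> left_retract_on X X Y \<phi> n"

definition bi_retract_ae ::
  "(int \<Rightarrow> 'a) set \<Rightarrow> (int \<Rightarrow> 'b) set \<Rightarrow> ((int \<Rightarrow> 'a) \<Rightarrow> (int \<Rightarrow> 'b)) \<Rightarrow> nat \<Rightarrow> bool" where
  "bi_retract_ae X Y \<phi> n \<longleftrightarrow>
     right_retract_on {x. left_transitive X x} X Y \<phi> n \<and>
     left_retract_on {x. right_transitive X x} X Y \<phi> n"

end

theory Submission
  imports Defs "HOL-Library.Sublist"
begin

text \<open>
  The proof has two independent halves.

  First, either hypothesis forces \<open>X\<close> to be irreducible. If \<open>\<phi>\<close> is an irreducible map onto an
  irreducible \<open>Y\<close>, every cylinder of \<open>X\<close> contains the full preimage of some cylinder of \<open>Y\<close>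
  (\<open>irreducible_map_cylinder\<close>), so that words of \<open>X\<close> can be joined because words of \<open>Y\<close>
  can. If every proper subsystem has smaller entropy, suppose that no word of \<open>X\<close> has the form
  \<open>u w v\<close>. Then cutting a word that contains \<open>u\<close> right after its first \<open>u\<close> writes it as \<open>s c t\<close> with \<open>s\<close>
  avoiding \<open>u\<close>, \<open>c\<close> a single letter and \<open>t\<close> avoiding \<open>v\<close>. The points of \<open>X\<close> that
  avoid \<open>u\<close>, and those that avoid \<open>v\<close>, form proper subsystems, so that the words avoiding
  \<open>u\<close> or \<open>v\<close> grow at an exponential rate below \<open>h(X)\<close> (\<open>avoiding_blocks_growth\<close>);
  there are then too few words \<open>s c t\<close> to account for all words of \<open>X\<close>.

  Second, if \<open>X\<close> is irreducible, its left (right) transitive points are dense by the Baire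
  category theorem, and the retract property passes from a dense set to all of \<open>X\<close>
  (\<open>lift_property_extends_from_dense\<close>): given \<open>x\<close> and \<open>y\<close> with \<open>\<phi>(x) = y\<close> on a half
  line, approximate \<open>x\<close> by a transitive point \<open>s\<close>, replace \<open>y\<close> by the point that equals
  \<open>\<phi>(s)\<close> on the half line and \<open>y\<close> off it, which lies in \<open>Y\<close> because \<open>Y\<close> is of finite
  type, lift this point, and pass to the limit by compactness. The same \<open>n\<close> is thus a bi-retract
  everywhere. Finally, translating asymptotic points until their images agree on the half line at
  \<open>0\<close> derives the bi-continuing property from the retract property.
\<close>

section \<open>Topology of shift spaces\<close>

text \<open>
  The points that agree with \<open>x\<close> at all coordinates in \<open>[-k, k]\<close> form the basic
  neighbourhoods of \<open>x\<close>.
\<close>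

definition agree :: "nat \<Rightarrow> (int \<Rightarrow> 'a) \<Rightarrow> (int \<Rightarrow> 'a) \<Rightarrow> bool" where
  "agree k x z \<longleftrightarrow> (\<forall>i. \<bar>i\<bar> \<le> int k \<longrightarrow> x i = z i)"

lemma agreeD: "agree k x z \<Longrightarrow> \<bar>i\<bar> \<le> int k \<Longrightarrow> x i = z i"
  by (simp add: agree_def)

lemma agree_mono: "agree k x z \<Longrightarrow> m \<le> k \<Longrightarrow> agree m x z"
  by (auto simp: agree_def)

lemma topspace_config [simp]: "topspace config_topology = UNIV"
  by (simp add: config_topology_def)

lemma Hausdorff_config: "Hausdorff_space config_topology"
  by (simp add: config_topology_def Hausdorff_space_product_topology)

lemma openin_config_iff:
  "openin config_topology U \<longleftrightarrow> (\<forall>x\<in>U. \<exists>k. \<forall>z. agree k x z \<longrightarrow> z \<in> U)"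
proof
  assume U: "openin config_topology U"
  show "\<forall>x\<in>U. \<exists>k. \<forall>z. agree k x z \<longrightarrow> z \<in> U"
  proof
    fix x assume "x \<in> U"
    then obtain V where V: "x \<in> (\<Pi>\<^sub>E i\<in>UNIV. V i)" "finite {i. V i \<noteq> UNIV}"
        "(\<Pi>\<^sub>E i\<in>UNIV. V i) \<subseteq> U"
      using product_topology_open_contains_basis[OF U[unfolded config_topology_def] \<open>x \<in> U\<close>] by auto
    obtain k where k: "\<And>i. V i \<noteq> UNIV \<Longrightarrow> nat \<bar>i\<bar> \<le> k"
      using V(2) finite_nat_set_iff_bounded_le[of "(\<lambda>i. nat \<bar>i\<bar>) ` {i. V i \<noteq> UNIV}"] by auto
    have "z \<in> U" if z: "agree k x z" for z
    proof -
      have "z i \<in> V i" for i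
      proof (cases "V i = UNIV")
        case False
        then have "x i = z i" using k[of i] by (intro agreeD[OF z]) simp
        then show ?thesis using V(1) by (metis PiE_iff UNIV_I)
      qed simp
      then show ?thesis
        using V(3) by (auto simp: PiE_iff)
    qed
    then show "\<exists>k. \<forall>z. agree k x z \<longrightarrow> z \<in> U" by blast
  qed
next
  assume R: "\<forall>x\<in>U. \<exists>k. \<forall>z. agree k x z \<longrightarrow> z \<in> U"
  show "openin config_topology U"
  proof (subst openin_subopen, intro ballI)
    fix x assume "x \<in> U"
    then obtain k where k: "\<And>z. agree k x z \<Longrightarrow> z \<in> U"
      using R by blast
    let ?V = "\<lambda>i. if \<bar>i\<bar> \<le> int k then {x i} else UNIV"
    have "finite {i. ?V i \<noteq> UNIV}"
      by (rule finite_subset[of _ "{- int k..int k}"]) auto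
    then have "openin config_topology (PiE UNIV ?V)"
      by (simp add: config_topology_def openin_PiE_gen)
    moreover have "PiE UNIV ?V \<subseteq> U"
    proof
      fix z assume z: "z \<in> PiE UNIV ?V"
      have "agree k x z"
        unfolding agree_def
      proof (intro allI impI)
        fix i :: int assume "\<bar>i\<bar> \<le> int k"
        moreover have "z i \<in> ?V i" using z by blast
        ultimately show "x i = z i" by simp
      qed
      then show "z \<in> U" by (rule k)
    qed
    ultimately show "\<exists>T. openin config_topology T \<and> x \<in> T \<and> T \<subseteq> U"
      by (intro exI[of _ "PiE UNIV ?V"]) auto
  qed
qed

lemma openin_config_window:
  assumes "\<And>x z. agree k x z \<Longrightarrow> P x \<Longrightarrow> P z"
  shows "openin config_topology {x. P x}"
  unfolding openin_config_iff using assms by blast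

lemma closedin_config_window:
  assumes "\<And>x z. agree k x z \<Longrightarrow> P z \<Longrightarrow> P x"
  shows "closedin config_topology {x. P x}"
proof -
  have "openin config_topology {x. \<not> P x}"
    by (rule openin_config_window[of k]) (use assms in blast)
  then show ?thesis
    by (simp add: closedin_def Collect_neg_eq Compl_eq_Diff_UNIV)
qed

lemma compactin_shift_space:
  assumes "shift_space X"
  shows "compactin config_topology X"
proof -
  obtain A where A: "finite A" "\<And>x. x \<in> X \<Longrightarrow> range x \<subseteq> A" and cl: "closedin config_topology X"
    using assms by (auto simp: shift_space_def)
  have "compactin config_topology (PiE UNIV (\<lambda>_. A))"
    using A(1) by (simp add: config_topology_def compactin_PiE finite_imp_compactin)
  then show ?thesis
    by (rule closed_compactin) (use A(2) cl in \<open>auto simp: image_subset_iff\<close>)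
qed

text \<open>
  Compactness in the form used for passing to limits: instead of extracting a convergent subsequence
  of approximate solutions, intersect the nested closed sets of \<open>k\<close>-th approximate solutions.
\<close>

lemma shift_space_nested_closed:
  assumes X: "shift_space X"
    and cl: "\<And>k::nat. closedin config_topology (C k)"
    and ne: "\<And>k. \<exists>x\<in>X. x \<in> C k"
    and dec: "\<And>j k. j \<le> k \<Longrightarrow> C k \<subseteq> C j"
  shows "\<exists>x\<in>X. \<forall>k. x \<in> C k"
proof -
  have "(\<Inter>k. X \<inter> C k) \<noteq> {}"
  proof (rule compact_space_imp_nest[where X = "top_of_shift X"])
    show "compact_space (top_of_shift X)"
      using X by (simp add: compact_space_subtopology compactin_shift_space)
    show "closedin (top_of_shift X) (X \<inter> C k)" for k
      using cl by (auto simp: closedin_subtopology)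
    show "X \<inter> C k \<noteq> {}" for k using ne by blast
    show "decseq (\<lambda>k. X \<inter> C k)" using dec by (force simp: decseq_def)
  qed
  then show ?thesis by auto
qed

lemma shift_space_translate:
  assumes X: "shift_space X" and x: "x \<in> X"
  shows "(\<lambda>i. x (i + k)) \<in> X"
proof (induction k rule: int_induct[where k = 0])
  case base
  then show ?case using x by simp
next
  case (step1 k)
  have "shift (\<lambda>i. x (i + k)) \<in> X"
    using X step1 by (auto simp: shift_space_def)
  then show ?case by (simp add: shift_def algebra_simps)
next
  case (step2 k)
  then obtain z where "z \<in> X" "shift z = (\<lambda>i. x (i + k))"
    using X unfolding shift_space_def by (metis imageE)
  moreover from this have "z = (\<lambda>i. x (i + (k - 1)))"
  proof -
    have "z i = x (i + (k - 1))" for i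
      using fun_cong[OF \<open>shift z = _\<close>, of "i - 1"] by (simp add: shift_def algebra_simps)
    then show ?thesis by blast
  qed
  ultimately show ?case by simp
qed

lemma code_translate:
  assumes X: "shift_space X" and c: "code X Y \<phi>" and x: "x \<in> X"
  shows "\<phi> (\<lambda>i. x (i + k)) = (\<lambda>i. \<phi> x (i + k))"
proof -
  have sh: "\<phi> (\<lambda>i. z (i + 1)) = (\<lambda>i. \<phi> z (i + 1))" if "z \<in> X" for z
    using c that by (simp add: code_def shift_def)
  show ?thesis
  proof (induction k rule: int_induct[where k = 0])
    case base
    then show ?case by simp
  next
    case (step1 k)
    have "\<phi> (\<lambda>i. x (i + 1 + k)) = (\<lambda>i. \<phi> x (i + 1 + k))"
      using sh[OF shift_space_translate[OF X x, of k]] step1(2) by (simp only:)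
    moreover have "i + 1 + k = i + (k + 1)" for i :: int by simp
    ultimately show ?case by (simp only:)
  next
    case (step2 k)
    have "i + 1 + (k - 1) = i + k" for i :: int by simp
    then have "\<phi> (\<lambda>i. x (i + k)) = (\<lambda>i. \<phi> (\<lambda>i. x (i + (k - 1))) (i + 1))"
      using sh[OF shift_space_translate[OF X x, of "k - 1"]] by (simp only:)
    then have *: "\<phi> (\<lambda>i. x (i + (k - 1))) (i + 1) = \<phi> x (i + k)" for i
      using fun_cong[OF step2(2), of i] by simp
    show ?case
    proof
      show "\<phi> (\<lambda>i. x (i + (k - 1))) i = \<phi> x (i + (k - 1))" for i
        using *[of "i - 1"] by (simp add: algebra_simps)
    qed
  qed
qed

text \<open>
  Continuity at a single point. This replaces the sliding block representation of a code, whose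
  uniform window is not required.
\<close>

lemma code_local:
  assumes c: "code X Y \<phi>" and x: "x \<in> X"
  obtains k where "\<And>z. z \<in> X \<Longrightarrow> agree k x z \<Longrightarrow> agree m (\<phi> x) (\<phi> z)"
proof -
  have cont: "continuous_map (top_of_shift X) config_topology \<phi>"
    using c by (simp add: code_def continuous_map_in_subtopology)
  have "openin config_topology {y. agree m (\<phi> x) y}"
    by (rule openin_config_window[of m]) (auto simp: agree_def)
  then have "openin (top_of_shift X) {z \<in> X. agree m (\<phi> x) (\<phi> z)}"
    using openin_continuous_map_preimage[OF cont] by fastforce
  then obtain T where T: "openin config_topology T" "{z \<in> X. agree m (\<phi> x) (\<phi> z)} = T \<inter> X"
    by (auto simp: openin_subtopology)
  moreover have "x \<in> {z \<in> X. agree m (\<phi> x) (\<phi> z)}" using x by (simp add: agree_def)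
  ultimately obtain k where "\<And>z. agree k x z \<Longrightarrow> z \<in> T"
    unfolding openin_config_iff by blast
  then show ?thesis using that T(2) by blast
qed

section \<open>Words\<close>

lemma occurs_at_iff: "occurs_at w x i \<longleftrightarrow> (\<forall>j<length w. x (i + int j) = w ! j)"
  by (simp add: occurs_at_def word_at_def list_eq_iff_nth_eq[of _ w])

lemma length_word_at [simp]: "length (word_at x i n) = n"
  by (simp add: word_at_def)

lemma occurs_at_word_at [simp]: "occurs_at (word_at x i n) x i"
  by (simp add: occurs_at_def)

lemma occurs_at_central_word:
  assumes "occurs_at (word_at x (- int k) (2 * k + 1)) z (- int k)"
  shows "agree k x z"
  unfolding agree_def
proof (intro allI impI)
  fix i :: int assume "\<bar>i\<bar> \<le> int k"
  then have "nat (i + int k) < 2 * k + 1" "- int k + int (nat (i + int k)) = i" by auto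
  then show "x i = z i"
    using assms unfolding occurs_at_iff length_word_at
    by (metis (no_types, lifting) add.left_neutral diff_zero length_upt nth_map nth_upt word_at_def)
qed

lemma occurs_at_append:
  "occurs_at (u @ v) x i \<longleftrightarrow> occurs_at u x i \<and> occurs_at v x (i + int (length u))"
proof
  assume "occurs_at (u @ v) x i"
  then have *: "x (i + int j) = (u @ v) ! j" if "j < length u + length v" for j
    using that by (simp add: occurs_at_iff)
  show "occurs_at u x i \<and> occurs_at v x (i + int (length u))"
    unfolding occurs_at_iff
  proof (intro conjI allI impI)
    fix j assume "j < length u"
    then show "x (i + int j) = u ! j" using *[of j] by (simp add: nth_append)
  next
    fix j assume "j < length v"
    then show "x (i + int (length u) + int j) = v ! j"
      using *[of "length u + j"] by (simp add: ac_simps nth_append)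
  qed
next
  assume *: "occurs_at u x i \<and> occurs_at v x (i + int (length u))"
  show "occurs_at (u @ v) x i"
    unfolding occurs_at_iff
  proof (intro allI impI)
    fix j assume j: "j < length (u @ v)"
    show "x (i + int j) = (u @ v) ! j"
    proof (cases "j < length u")
      case True
      then show ?thesis using * by (simp add: occurs_at_iff nth_append)
    next
      case False
      then have "j - length u < length v" using j by auto
      then have "x (i + int (length u) + int (j - length u)) = v ! (j - length u)"
        using * unfolding occurs_at_iff by blast
      moreover have "i + int (length u) + int (j - length u) = i + int j" using False by simp
      ultimately show ?thesis using False by (simp add: nth_append)
    qed
  qed
qed

lemma occurs_at_translate: "occurs_at w (\<lambda>i. x (i + k)) j \<longleftrightarrow> occurs_at w x (j + k)"
  by (simp add: occurs_at_iff algebra_simps)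

lemma occurs_at_cong:
  assumes "\<And>j. i \<le> j \<Longrightarrow> j < i + int (length w) \<Longrightarrow> x j = z j"
  shows "occurs_at w x i \<longleftrightarrow> occurs_at w z i"
  using assms by (auto simp: occurs_at_iff)

lemma language_infix: "p @ w @ q \<in> language X \<Longrightarrow> w \<in> language X"
  unfolding language_def mem_Collect_eq occurs_at_append by blast

lemma word_at_in_language: "x \<in> X \<Longrightarrow> word_at x i n \<in> language X"
  unfolding language_def using occurs_at_word_at by blast

lemma language_occurs_at:
  assumes X: "shift_space X" and w: "w \<in> language X"
  obtains x where "x \<in> X" "occurs_at w x i"
proof -
  obtain x j where x: "x \<in> X" "occurs_at w x j"
    using w by (auto simp: language_def)
  show ?thesis
  proof (rule that)
    show "(\<lambda>l. x (l + (j - i))) \<in> X" using shift_space_translate[OF X x(1)] .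
    show "occurs_at w (\<lambda>l. x (l + (j - i))) i" using x(2) by (simp add: occurs_at_translate)
  qed
qed

text \<open>
  In an irreducible shift the connecting word can be taken as long as desired, since \<open>u\<close> may be
  extended to the right before connecting it to \<open>v\<close>.
\<close>

lemma irreducible_shift_gap:
  assumes X: "shift_space X" and irr: "irreducible_shift X"
    and u: "u \<in> language X" and v: "v \<in> language X"
  obtains w where "n \<le> length w" "u @ w @ v \<in> language X"
proof -
  obtain x where x: "x \<in> X" "occurs_at u x 0"
    using language_occurs_at[OF X u] .
  let ?r = "word_at x (int (length u)) n"
  have "occurs_at (u @ ?r) x 0" using x(2) by (simp add: occurs_at_append)
  then have "u @ ?r \<in> language X" using x(1) by (auto simp: language_def)
  then obtain w where "(u @ ?r) @ w @ v \<in> language X"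
    using irr v unfolding irreducible_shift_def by blast
  then show ?thesis using that[of "?r @ w"] by simp
qed

lemma finite_words_alphabet:
  assumes "shift_space X"
  obtains A where "finite A" "\<And>w. w \<in> language X \<Longrightarrow> set w \<subseteq> A"
proof -
  obtain A where A: "finite A" "\<And>x. x \<in> X \<Longrightarrow> range x \<subseteq> A"
    using assms by (auto simp: shift_space_def)
  have "set w \<subseteq> A" if w: "w \<in> language X" for w
  proof -
    obtain x i where x: "x \<in> X" "occurs_at w x i" using w unfolding language_def by blast
    have "w ! j \<in> A" if "j < length w" for j
      using A(2)[OF x(1)] x(2) that unfolding occurs_at_iff by (metis rangeI subsetD)
    then show ?thesis by (auto simp: in_set_conv_nth)
  qed
  then show ?thesis using that A(1) by blast
qed

lemma finite_blocks: "shift_space X \<Longrightarrow> finite (blocks n X)"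
proof -
  assume "shift_space X"
  then obtain A where A: "finite A" "\<And>w. w \<in> language X \<Longrightarrow> set w \<subseteq> A"
    by (rule finite_words_alphabet) blast
  show ?thesis
    by (rule finite_subset[OF _ finite_lists_length_eq[OF A(1), of n]]) (use A(2) in \<open>auto simp: blocks_def\<close>)
qed

lemma countable_language: "shift_space X \<Longrightarrow> countable (language X)"
proof -
  assume "shift_space X"
  moreover have "language X = (\<Union>n. blocks n X)" by (auto simp: blocks_def)
  ultimately show ?thesis by (simp add: finite_blocks countable_finite)
qed

section \<open>Retracts extend from a dense set\<close>

text \<open>
  If \<open>M\<close> bounds the lengths of the forbidden words, two points that agree at the
  coordinates within distance \<open>M\<close> of \<open>0\<close> on one side can be spliced at \<open>0\<close>: each forbidden word at a given
  position in the spliced point would already be found there in one of the two points.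
\<close>

lemma SFT_splice:
  assumes "shift_of_finite_type Y"
  obtains M where
    "\<And>a b. a \<in> Y \<Longrightarrow> b \<in> Y \<Longrightarrow> (\<And>i. i \<le> 0 \<Longrightarrow> \<bar>i\<bar> \<le> int M \<Longrightarrow> a i = b i) \<Longrightarrow>
       (\<lambda>i. if i \<le> 0 then a i else b i) \<in> Y"
    "\<And>a b. a \<in> Y \<Longrightarrow> b \<in> Y \<Longrightarrow> (\<And>i. i \<ge> 0 \<Longrightarrow> \<bar>i\<bar> \<le> int M \<Longrightarrow> a i = b i) \<Longrightarrow>
       (\<lambda>i. if i \<ge> 0 then a i else b i) \<in> Y"
proof -
  obtain A F where F: "finite F"
    and Y: "Y = {y. range y \<subseteq> A \<and> (\<forall>w\<in>F. \<forall>i. \<not> occurs_at w y i)}"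
    using assms by (auto simp: shift_of_finite_type_def)
  obtain M where M: "\<And>w. w \<in> F \<Longrightarrow> length w \<le> M"
    using F finite_nat_set_iff_bounded_le[of "length ` F"] by auto
  have splice: "c \<in> Y"
    if ab: "a \<in> Y" "b \<in> Y"
      and c: "\<And>i. c i = a i \<or> c i = b i"
      and win: "\<And>i. (\<forall>j. i \<le> j \<and> j < i + int M \<longrightarrow> c j = a j) \<or>
                 (\<forall>j. i \<le> j \<and> j < i + int M \<longrightarrow> c j = b j)" for a b c
  proof -
    have "c i \<in> A" for i
      using ab c[of i] unfolding Y by auto
    moreover have "\<not> occurs_at w c i" if w: "w \<in> F" for w i
    proof -
      have "(occurs_at w c i \<longleftrightarrow> occurs_at w a i) \<or> (occurs_at w c i \<longleftrightarrow> occurs_at w b i)"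
        using win[of i]
      proof
        assume "\<forall>j. i \<le> j \<and> j < i + int M \<longrightarrow> c j = a j"
        then show ?thesis
          using M[OF w] by (intro disjI1 occurs_at_cong) auto
      next
        assume "\<forall>j. i \<le> j \<and> j < i + int M \<longrightarrow> c j = b j"
        then show ?thesis
          using M[OF w] by (intro disjI2 occurs_at_cong) auto
      qed
      then show ?thesis using ab w unfolding Y by blast
    qed
    ultimately show ?thesis unfolding Y by auto
  qed
  show ?thesis
  proof (rule that[of M])
    fix a b
    assume ab: "a \<in> Y" "b \<in> Y" and eq: "\<And>i. i \<le> 0 \<Longrightarrow> \<bar>i\<bar> \<le> int M \<Longrightarrow> a i = b i"
    show "(\<lambda>i. if i \<le> 0 then a i else b i) \<in> Y"
    proof (rule splice[OF ab])
      fix i :: int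
      show "(\<forall>j. i \<le> j \<and> j < i + int M \<longrightarrow> (if j \<le> 0 then a j else b j) = a j) \<or>
            (\<forall>j. i \<le> j \<and> j < i + int M \<longrightarrow> (if j \<le> 0 then a j else b j) = b j)"
        by (cases "i < - int M") (auto intro!: eq)
    qed auto
  next
    fix a b
    assume ab: "a \<in> Y" "b \<in> Y" and eq: "\<And>i. i \<ge> 0 \<Longrightarrow> \<bar>i\<bar> \<le> int M \<Longrightarrow> a i = b i"
    show "(\<lambda>i. if i \<ge> 0 then a i else b i) \<in> Y"
    proof (rule splice[OF ab])
      fix i :: int
      show "(\<forall>j. i \<le> j \<and> j < i + int M \<longrightarrow> (if j \<ge> 0 then a j else b j) = a j) \<or>
            (\<forall>j. i \<le> j \<and> j < i + int M \<longrightarrow> (if j \<ge> 0 then a j else b j) = b j)"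
        by (cases "i \<ge> 0") (auto intro!: eq)
    qed auto
  qed
qed

text \<open>
  \<open>P\<close> and \<open>Q\<close> describe the half lines on which \<open>\<phi>(x)\<close> agrees with \<open>y\<close> and the lift
  agrees with \<open>x\<close>, so that the lemma covers right and left retracts at the same time.
\<close>

lemma lift_property_extends_from_dense:
  fixes P Q :: "int \<Rightarrow> bool"
  assumes X: "shift_space X" and fc: "factor_code X Y \<phi>"
    and splice: "\<And>a b. a \<in> Y \<Longrightarrow> b \<in> Y \<Longrightarrow> (\<And>i. P i \<Longrightarrow> \<bar>i\<bar> \<le> int M \<Longrightarrow> a i = b i) \<Longrightarrow>
       (\<lambda>i. if P i then a i else b i) \<in> Y"
    and dense: "\<And>x k. x \<in> X \<Longrightarrow> \<exists>s\<in>S. agree k x s"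
    and SX: "S \<subseteq> X"
    and lift: "\<And>x y. x \<in> S \<Longrightarrow> y \<in> Y \<Longrightarrow> (\<And>i. P i \<Longrightarrow> \<phi> x i = y i) \<Longrightarrow>
       \<exists>x'\<in>X. \<phi> x' = y \<and> (\<forall>i. Q i \<longrightarrow> x' i = x i)"
    and x: "x \<in> X" and y: "y \<in> Y" and xy: "\<And>i. P i \<Longrightarrow> \<phi> x i = y i"
  shows "\<exists>x'\<in>X. \<phi> x' = y \<and> (\<forall>i. Q i \<longrightarrow> x' i = x i)"
proof -
  have c: "code X Y \<phi>" and onto: "\<phi> ` X = Y"
    using fc by (auto simp: factor_code_def)
  \<comment> \<open>the lifts that are correct up to distance \<open>k\<close> from the origin\<close>
  define D where "D k = {z \<in> X. agree k (\<phi> z) y \<and> (\<forall>i. Q i \<longrightarrow> \<bar>i\<bar> \<le> int k \<longrightarrow> z i = x i)}" for k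
  have cl: "closedin config_topology (D k)" for k
  proof -
    have cX: "closedin config_topology X" using X by (simp add: shift_space_def)
    have cont: "continuous_map (top_of_shift X) config_topology \<phi>"
      using c by (simp add: code_def continuous_map_in_subtopology)
    have "closedin config_topology {u. agree k u y}"
      by (rule closedin_config_window[of k]) (auto simp: agree_def)
    then have "closedin (top_of_shift X) {z \<in> X. agree k (\<phi> z) y}"
      using closedin_continuous_map_preimage[OF cont] by fastforce
    then have 1: "closedin config_topology {z \<in> X. agree k (\<phi> z) y}"
      using cX closedin_closed_subtopology by blast
    have 2: "closedin config_topology {z. \<forall>i. Q i \<longrightarrow> \<bar>i\<bar> \<le> int k \<longrightarrow> z i = x i}"
      by (rule closedin_config_window[of k]) (auto simp: agree_def)
    have "D k = {z \<in> X. agree k (\<phi> z) y} \<inter> {z. \<forall>i. Q i \<longrightarrow> \<bar>i\<bar> \<le> int k \<longrightarrow> z i = x i}"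
      by (auto simp: D_def)
    then show ?thesis using 1 2 by (simp add: closedin_Int)
  qed
  have ne: "\<exists>z\<in>X. z \<in> D k" for k
  proof -
    obtain l where l: "\<And>z. z \<in> X \<Longrightarrow> agree l x z \<Longrightarrow> agree (max M k) (\<phi> x) (\<phi> z)"
      using code_local[OF c x] by blast
    \<comment> \<open>close enough to \<open>x\<close> both for \<open>\<phi>(s)\<close> to be spliced with \<open>y\<close> and for a lift to lie in \<open>D k\<close>\<close>
    obtain s where s: "s \<in> S" "agree (max l k) x s"
      using dense[OF x] by blast
    have \<phi>s: "\<phi> x i = \<phi> s i" if "\<bar>i\<bar> \<le> int (max M k)" for i
      using l[of s] s SX agreeD that by (metis agree_mono max.cobounded1 subsetD)
    define y' where "y' = (\<lambda>i. if P i then \<phi> s i else y i)"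
    have "y' \<in> Y"
      unfolding y'_def
    proof (rule splice[OF _ y])
      show "\<phi> s \<in> Y" using s(1) SX onto by blast
      show "\<phi> s i = y i" if "P i" "\<bar>i\<bar> \<le> int M" for i
        using \<phi>s[of i] xy[OF that(1)] that(2) by simp
    qed
    then obtain z where z: "z \<in> X" "\<phi> z = y'" "\<And>i. Q i \<Longrightarrow> z i = s i"
      using lift[OF s(1), of y'] by (auto simp: y'_def)
    have "agree k y' y"
      unfolding agree_def y'_def using \<phi>s xy by fastforce
    moreover have "s i = x i" if "\<bar>i\<bar> \<le> int k" for i
      using agreeD[OF s(2), of i] that by simp
    ultimately have "z \<in> D k" using z by (simp add: D_def)
    then show ?thesis using z(1) by blast
  qed
  have dec: "D k \<subseteq> D j" if "j \<le> k" for j k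
    using that by (auto simp: D_def intro: agree_mono)
  obtain z where z: "z \<in> X" "\<And>k. z \<in> D k"
    using shift_space_nested_closed[of X D, OF X cl ne dec] by auto
  have "\<phi> z i = y i" for i
    using z(2)[of "nat \<bar>i\<bar>"] by (auto simp: D_def agree_def)
  moreover have "z i = x i" if "Q i" for i
    using z(2)[of "nat \<bar>i\<bar>"] that by (auto simp: D_def)
  ultimately show ?thesis using z(1) by blast
qed

section \<open>From retracts to the continuing property\<close>

lemma right_retract_imp_right_continuing:
  assumes X: "shift_space X" and fc: "factor_code X Y \<phi>" and r: "right_retract_on X X Y \<phi> n"
  shows "right_continuing_on X X Y \<phi>"
  unfolding right_continuing_on_def
proof (intro ballI impI)
  fix x y assume x: "x \<in> X" and y: "y \<in> Y" and as: "left_asymptotic (\<phi> x) y"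
  have c: "code X Y \<phi>" and onto: "\<phi> ` X = Y"
    using fc by (auto simp: factor_code_def)
  note T = shift_space_translate[OF X] and C = code_translate[OF X c]
  obtain N where N: "\<And>i. i \<le> N \<Longrightarrow> \<phi> x i = y i"
    using as by (auto simp: left_asymptotic_def)
  have "(\<lambda>i. y (i + N)) \<in> Y"
  proof -
    obtain z where z: "z \<in> X" "y = \<phi> z" using y onto by blast
    then show ?thesis using onto T[OF z(1), of N] C[OF z(1), of N] by (metis imageI)
  qed
  moreover have "\<forall>i\<le>0. \<phi> (\<lambda>i. x (i + N)) i = y (i + N)"
    using N by (simp add: C[OF x])
  ultimately obtain x' where x': "x' \<in> X" "\<phi> x' = (\<lambda>i. y (i + N))"
      "\<And>i. i \<le> - int n \<Longrightarrow> x' i = x (i + N)"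
    using r T[OF x, of N] unfolding right_retract_on_def by fast
  show "\<exists>x'\<in>X. left_asymptotic x' x \<and> \<phi> x' = y"
  proof (intro bexI conjI)
    show "(\<lambda>i. x' (i + - N)) \<in> X" by (rule T[OF x'(1)])
    show "\<phi> (\<lambda>i. x' (i + - N)) = y"
      unfolding C[OF x'(1)] x'(2) by simp
    show "left_asymptotic (\<lambda>i. x' (i + - N)) x"
      unfolding left_asymptotic_def
      by (rule exI[of _ "N - int n"]) (simp add: x'(3))
  qed
qed

lemma left_retract_imp_left_continuing:
  assumes X: "shift_space X" and fc: "factor_code X Y \<phi>" and r: "left_retract_on X X Y \<phi> n"
  shows "left_continuing_on X X Y \<phi>"
  unfolding left_continuing_on_def
proof (intro ballI impI)
  fix x y assume x: "x \<in> X" and y: "y \<in> Y" and as: "right_asymptotic (\<phi> x) y"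
  have c: "code X Y \<phi>" and onto: "\<phi> ` X = Y"
    using fc by (auto simp: factor_code_def)
  note T = shift_space_translate[OF X] and C = code_translate[OF X c]
  obtain N where N: "\<And>i. i \<ge> N \<Longrightarrow> \<phi> x i = y i"
    using as by (auto simp: right_asymptotic_def)
  have "(\<lambda>i. y (i + N)) \<in> Y"
  proof -
    obtain z where z: "z \<in> X" "y = \<phi> z" using y onto by blast
    then show ?thesis using onto T[OF z(1), of N] C[OF z(1), of N] by (metis imageI)
  qed
  moreover have "\<forall>i\<ge>0. \<phi> (\<lambda>i. x (i + N)) i = y (i + N)"
    using N by (simp add: C[OF x])
  ultimately obtain x' where x': "x' \<in> X" "\<phi> x' = (\<lambda>i. y (i + N))"
      "\<And>i. i \<ge> int n \<Longrightarrow> x' i = x (i + N)"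
    using r T[OF x, of N] unfolding left_retract_on_def by fast
  show "\<exists>x'\<in>X. right_asymptotic x' x \<and> \<phi> x' = y"
  proof (intro bexI conjI)
    show "(\<lambda>i. x' (i + - N)) \<in> X" by (rule T[OF x'(1)])
    show "\<phi> (\<lambda>i. x' (i + - N)) = y"
      unfolding C[OF x'(1)] x'(2) by simp
    show "right_asymptotic (\<lambda>i. x' (i + - N)) x"
      unfolding right_asymptotic_def
      by (rule exI[of _ "N + int n"]) (simp add: x'(3))
  qed
qed

section \<open>Transitive points\<close>

text \<open>
  The Baire category theorem for a shift space, with density expressed by central windows.
\<close>

lemma dense_G_delta:
  assumes X: "shift_space X" and J: "countable J"
    and op: "\<And>j. j \<in> J \<Longrightarrow> openin config_topology (U j)"
    and dn: "\<And>j x k. j \<in> J \<Longrightarrow> x \<in> X \<Longrightarrow> \<exists>z\<in>X. agree k x z \<and> z \<in> U j"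
    and x: "x \<in> X"
  shows "\<exists>z\<in>X. agree k x z \<and> (\<forall>j\<in>J. z \<in> U j)"
proof (cases "J = {}")
  case True
  then show ?thesis using x by (auto simp: agree_def)
next
  case False
  let ?T = "top_of_shift X"
  have top: "topspace ?T = X" by simp
  have comp: "compact_space ?T"
    using X by (simp add: compact_space_subtopology compactin_shift_space)
  have reg: "regular_space ?T"
    using comp Hausdorff_space_subtopology[OF Hausdorff_config]
    by (intro compact_Hausdorff_imp_regular_space) auto
  have "?T closure_of \<Inter> ((\<lambda>j. X \<inter> U j) ` J) = topspace ?T"
  proof (rule Baire_category)
    show "completely_metrizable_space ?T \<or> locally_compact_space ?T \<and> regular_space ?T"
      using comp reg compact_imp_locally_compact_space by blast
    show "countable ((\<lambda>j. X \<inter> U j) ` J)" using J by simp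
    fix V assume "V \<in> (\<lambda>j. X \<inter> U j) ` J"
    then obtain j where j: "j \<in> J" "V = X \<inter> U j" by blast
    have "openin ?T V" using op[OF j(1)] j(2) by (auto simp: openin_subtopology)
    moreover have "?T closure_of V = topspace ?T"
      unfolding dense_intersects_open
    proof (intro allI impI, elim conjE)
      fix W assume "openin ?T W" "W \<noteq> {}"
      then obtain O' where O': "openin config_topology O'" "W = O' \<inter> X"
        by (auto simp: openin_subtopology)
      then obtain w where w: "w \<in> O'" "w \<in> X" using \<open>W \<noteq> {}\<close> by blast
      obtain k where k: "\<And>z. agree k w z \<Longrightarrow> z \<in> O'"
        using O'(1) w(1) unfolding openin_config_iff by blast
      obtain z where "z \<in> X" "agree k w z" "z \<in> U j" using dn[OF j(1) w(2)] by blast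
      then show "V \<inter> W \<noteq> {}" using k j(2) O'(2) by blast
    qed
    ultimately show "openin ?T V \<and> ?T closure_of V = topspace ?T" by blast
  qed
  moreover have "openin ?T ({z. agree k x z} \<inter> X)"
    using openin_config_window[of k "agree k x"] by (auto simp: openin_subtopology agree_def)
  moreover have "x \<in> {z. agree k x z} \<inter> X" using x by (simp add: agree_def)
  ultimately have "\<Inter> ((\<lambda>j. X \<inter> U j) ` J) \<inter> ({z. agree k x z} \<inter> X) \<noteq> {}"
    unfolding dense_intersects_open by blast
  then show ?thesis using False by auto
qed

lemma openin_occurs_somewhere:
  "openin config_topology {z. \<exists>i. R i \<and> occurs_at w z i}"
  unfolding openin_config_iff
proof (intro ballI)
  fix x assume "x \<in> {z. \<exists>i. R i \<and> occurs_at w z i}"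
  then obtain i where i: "R i" "occurs_at w x i" by blast
  have "occurs_at w z i" if z: "agree (nat (\<bar>i\<bar> + int (length w))) x z" for z
  proof -
    have "occurs_at w x i \<longleftrightarrow> occurs_at w z i"
      by (intro occurs_at_cong agreeD[OF z]) auto
    then show ?thesis using i(2) by simp
  qed
  then show "\<exists>k. \<forall>z. agree k x z \<longrightarrow> z \<in> {z. \<exists>i. R i \<and> occurs_at w z i}"
    using i(1) by blast
qed

lemma left_occurrence_dense:
  assumes X: "shift_space X" and irr: "irreducible_shift X" and w: "w \<in> language X"
    and x: "x \<in> X"
  shows "\<exists>z\<in>X. agree k x z \<and> (\<exists>i\<le>- int N. occurs_at w z i)"
proof -
  let ?c = "word_at x (- int k) (2 * k + 1)"
  obtain g where g: "N \<le> length g" "w @ g @ ?c \<in> language X"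
    using irreducible_shift_gap[OF X irr w word_at_in_language[OF x]] .
  let ?i = "- int k - int (length g) - int (length w)"
  obtain z where z: "z \<in> X" "occurs_at (w @ g @ ?c) z ?i"
    using language_occurs_at[OF X g(2)] .
  then have wz: "occurs_at w z ?i" and cz: "occurs_at ?c z (- int k)"
    by (simp_all add: occurs_at_append)
  have "agree k x z" using cz by (rule occurs_at_central_word)
  then show ?thesis using z(1) wz g(1) by (intro bexI[of _ z] conjI exI[of _ ?i]) auto
qed

lemma right_occurrence_dense:
  assumes X: "shift_space X" and irr: "irreducible_shift X" and w: "w \<in> language X"
    and x: "x \<in> X"
  shows "\<exists>z\<in>X. agree k x z \<and> (\<exists>i\<ge>int N. occurs_at w z i)"
proof -
  let ?c = "word_at x (- int k) (2 * k + 1)"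
  obtain g where g: "N \<le> length g" "?c @ g @ w \<in> language X"
    using irreducible_shift_gap[OF X irr word_at_in_language[OF x] w] .
  let ?i = "int k + 1 + int (length g)"
  obtain z where z: "z \<in> X" "occurs_at (?c @ g @ w) z (- int k)"
    using language_occurs_at[OF X g(2)] .
  then have wz: "occurs_at w z ?i" and cz: "occurs_at ?c z (- int k)"
    by (simp_all add: occurs_at_append)
  have "agree k x z" using cz by (rule occurs_at_central_word)
  then show ?thesis using z(1) wz g(1) by (intro bexI[of _ z] conjI exI[of _ ?i]) auto
qed

lemma left_transitive_dense:
  assumes X: "shift_space X" and irr: "irreducible_shift X" and x: "x \<in> X"
  shows "\<exists>z\<in>{z. left_transitive X z}. agree k x z"
proof -
  let ?U = "\<lambda>(w, N). {z. \<exists>i. i \<le> - int N \<and> occurs_at w z i}"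
  have "\<exists>z\<in>X. agree k x z \<and> (\<forall>j\<in>language X \<times> UNIV. z \<in> ?U j)"
    by (rule dense_G_delta[OF X _ _ _ x])
       (use countable_language[OF X] left_occurrence_dense[OF X irr] in
         \<open>auto simp: openin_occurs_somewhere\<close>)
  then obtain z where z: "z \<in> X" "agree k x z"
    and occ: "\<And>w N. w \<in> language X \<Longrightarrow> \<exists>i\<le>- int N. occurs_at w z i"
    by fastforce
  have "infinite {i. i \<le> 0 \<and> occurs_at w z i}" if w: "w \<in> language X" for w
  proof
    assume "finite {i. i \<le> 0 \<and> occurs_at w z i}"
    then obtain b where b: "\<And>i. i \<le> 0 \<Longrightarrow> occurs_at w z i \<Longrightarrow> b \<le> i"
      using bdd_below_finite[of "{i. i \<le> 0 \<and> occurs_at w z i}"] unfolding bdd_below_def by blast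
    obtain i where "i \<le> - int (nat (\<bar>b\<bar> + 1))" "occurs_at w z i" using occ[OF w] by blast
    then show False using b[of i] by linarith
  qed
  then have "left_transitive X z" using z(1) by (simp add: left_transitive_def)
  then show ?thesis using z(2) by blast
qed

lemma right_transitive_dense:
  assumes X: "shift_space X" and irr: "irreducible_shift X" and x: "x \<in> X"
  shows "\<exists>z\<in>{z. right_transitive X z}. agree k x z"
proof -
  let ?U = "\<lambda>(w, N). {z. \<exists>i. i \<ge> int N \<and> occurs_at w z i}"
  have "\<exists>z\<in>X. agree k x z \<and> (\<forall>j\<in>language X \<times> UNIV. z \<in> ?U j)"
    by (rule dense_G_delta[OF X _ _ _ x])
       (use countable_language[OF X] right_occurrence_dense[OF X irr] in
         \<open>auto simp: openin_occurs_somewhere\<close>)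
  then obtain z where z: "z \<in> X" "agree k x z"
    and occ: "\<And>w N. w \<in> language X \<Longrightarrow> \<exists>i\<ge>int N. occurs_at w z i"
    by fastforce
  have "infinite {i. i \<ge> 0 \<and> occurs_at w z i}" if w: "w \<in> language X" for w
  proof
    assume "finite {i. i \<ge> 0 \<and> occurs_at w z i}"
    then obtain b where b: "\<And>i. i \<ge> 0 \<Longrightarrow> occurs_at w z i \<Longrightarrow> i \<le> b"
      using bdd_above_finite[of "{i. i \<ge> 0 \<and> occurs_at w z i}"] unfolding bdd_above_def by blast
    obtain i where "i \<ge> int (nat (\<bar>b\<bar> + 1))" "occurs_at w z i" using occ[OF w] by blast
    then show False using b[of i] by linarith
  qed
  then have "right_transitive X z" using z(1) by (simp add: right_transitive_def)
  then show ?thesis using z(2) by blast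
qed

text \<open>
  Irreducibility of \<open>X\<close> is all that is needed for an a.e. bi-retract to be a bi-retract.
\<close>

lemma irreducible_domain_bi_retract:
  assumes X: "shift_space X" and Y: "shift_of_finite_type Y" and fc: "factor_code X Y \<phi>"
    and irr: "irreducible_shift X" and r: "bi_retract_ae X Y \<phi> n"
  shows "bi_retract X Y \<phi> n"
proof -
  obtain M where M:
    "\<And>a b. a \<in> Y \<Longrightarrow> b \<in> Y \<Longrightarrow> (\<And>i. i \<le> 0 \<Longrightarrow> \<bar>i\<bar> \<le> int M \<Longrightarrow> a i = b i) \<Longrightarrow>
       (\<lambda>i. if i \<le> 0 then a i else b i) \<in> Y"
    "\<And>a b. a \<in> Y \<Longrightarrow> b \<in> Y \<Longrightarrow> (\<And>i. i \<ge> 0 \<Longrightarrow> \<bar>i\<bar> \<le> int M \<Longrightarrow> a i = b i) \<Longrightarrow>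
       (\<lambda>i. if i \<ge> 0 then a i else b i) \<in> Y"
    using SFT_splice[OF Y] by blast
  have "right_retract_on X X Y \<phi> n"
    unfolding right_retract_on_def
  proof (intro ballI impI)
    fix x y assume *: "x \<in> X" "y \<in> Y" "\<forall>i\<le>0. \<phi> x i = y i"
    show "\<exists>x'\<in>X. \<phi> x' = y \<and> (\<forall>i\<le>- int n. x' i = x i)"
    proof (rule lift_property_extends_from_dense[where P = "\<lambda>i. i \<le> 0",
          OF X fc M(1) left_transitive_dense[OF X irr] _ _ *(1,2)])
      show "{x. left_transitive X x} \<subseteq> X" by (auto simp: left_transitive_def)
      show "\<exists>x'\<in>X. \<phi> x' = y \<and> (\<forall>i\<le>- int n. x' i = x i)"
        if "x \<in> {x. left_transitive X x}" "y \<in> Y" "\<And>i. i \<le> 0 \<Longrightarrow> \<phi> x i = y i" for x y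
        using r that unfolding bi_retract_ae_def right_retract_on_def by blast
    qed (use *(3) in auto)
  qed
  moreover have "left_retract_on X X Y \<phi> n"
    unfolding left_retract_on_def
  proof (intro ballI impI)
    fix x y assume *: "x \<in> X" "y \<in> Y" "\<forall>i\<ge>0. \<phi> x i = y i"
    show "\<exists>x'\<in>X. \<phi> x' = y \<and> (\<forall>i\<ge>int n. x' i = x i)"
    proof (rule lift_property_extends_from_dense[where P = "\<lambda>i. i \<ge> 0",
          OF X fc M(2) right_transitive_dense[OF X irr] _ _ *(1,2)])
      show "{x. right_transitive X x} \<subseteq> X" by (auto simp: right_transitive_def)
      show "\<exists>x'\<in>X. \<phi> x' = y \<and> (\<forall>i\<ge>int n. x' i = x i)"
        if "x \<in> {x. right_transitive X x}" "y \<in> Y" "\<And>i. i \<ge> 0 \<Longrightarrow> \<phi> x i = y i" for x y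
        using r that unfolding bi_retract_ae_def left_retract_on_def by blast
    qed (use *(3) in auto)
  qed
  ultimately show ?thesis by (simp add: bi_retract_def)
qed

section \<open>Domains of irreducible maps\<close>

lemma factor_shift_space:
  assumes X: "shift_space X" and Y: "shift_of_finite_type Y" and fc: "factor_code X Y \<phi>"
  shows "shift_space Y"
proof -
  have c: "code X Y \<phi>" and onto: "\<phi> ` X = Y"
    using fc by (auto simp: factor_code_def)
  have cont: "continuous_map (top_of_shift X) config_topology \<phi>"
    using c by (simp add: code_def continuous_map_in_subtopology)
  have "compactin (top_of_shift X) X"
    using compactin_shift_space[OF X] by (simp add: compactin_subtopology)
  then have "compactin config_topology Y"
    using image_compactin[OF _ cont] onto by blast
  then have cl: "closedin config_topology Y"
    using compactin_imp_closedin[OF Hausdorff_config] by blast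
  have fin: "\<exists>A. finite A \<and> (\<forall>y\<in>Y. range y \<subseteq> A)"
    using Y by (auto simp: shift_of_finite_type_def)
  have "shift ` Y = \<phi> ` shift ` X"
    using c onto by (auto simp: code_def image_iff)
  then have "shift ` Y = Y"
    using X onto by (simp add: shift_space_def)
  then show ?thesis using cl fin by (simp add: shift_space_def)
qed

text \<open>
  The points that do not have \<open>u\<close> at the origin form a proper closed subset of \<open>X\<close>. Its image
  is closed and omits some \<open>y\<close>, hence a whole cylinder around \<open>y\<close>.
\<close>

lemma irreducible_map_cylinder:
  assumes X: "shift_space X" and fc: "factor_code X Y \<phi>" and irr: "irreducible_map X \<phi>"
    and u: "u \<in> language X"
  obtains y k where "y \<in> Y" "\<And>x. x \<in> X \<Longrightarrow> agree k y (\<phi> x) \<Longrightarrow> occurs_at u x 0"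
proof -
  have c: "code X Y \<phi>" and onto: "\<phi> ` X = Y"
    using fc by (auto simp: factor_code_def)
  have cont: "continuous_map (top_of_shift X) config_topology \<phi>"
    using c by (simp add: code_def continuous_map_in_subtopology)
  let ?A = "{x \<in> X. \<not> occurs_at u x 0}"
  have "openin config_topology {x. occurs_at u x 0}"
    using openin_occurs_somewhere[of "\<lambda>i. i = 0" u] by simp
  then have "closedin config_topology {x. \<not> occurs_at u x 0}"
    by (simp add: closedin_def Collect_neg_eq Compl_eq_Diff_UNIV double_diff)
  then have cA: "closedin (top_of_shift X) ?A"
    by (auto simp: closedin_subtopology)
  obtain x where "x \<in> X" "occurs_at u x 0"
    using language_occurs_at[OF X u] .
  then have "?A \<noteq> X" by blast
  then have "\<phi> ` ?A \<noteq> Y" using irr cA onto unfolding irreducible_map_def by blast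
  then obtain y where y: "y \<in> Y" "y \<notin> \<phi> ` ?A" using onto by blast
  have "compact_space (top_of_shift X)"
    using compactin_shift_space[OF X] by (simp add: compact_space_subtopology)
  then have "compactin (top_of_shift X) ?A" using cA by (rule closedin_compact_space)
  then have "compactin config_topology (\<phi> ` ?A)" by (rule image_compactin[OF _ cont])
  then have "closedin config_topology (\<phi> ` ?A)"
    using compactin_imp_closedin[OF Hausdorff_config] by blast
  then have "openin config_topology (- \<phi> ` ?A)"
    by (simp add: closedin_def Compl_eq_Diff_UNIV)
  then obtain k where "\<And>z. agree k y z \<Longrightarrow> z \<notin> \<phi> ` ?A"
    using y(2) unfolding openin_config_iff by blast
  then show ?thesis using that[OF y(1)] by blast
qed

lemma irreducible_map_imp_irreducible_shift:
  assumes X: "shift_space X" and Y: "shift_space Y" and fc: "factor_code X Y \<phi>"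
    and irr: "irreducible_map X \<phi>" and irrY: "irreducible_shift Y"
  shows "irreducible_shift X"
  unfolding irreducible_shift_def
proof (intro ballI)
  fix u v assume u: "u \<in> language X" and v: "v \<in> language X"
  have c: "code X Y \<phi>" and onto: "\<phi> ` X = Y"
    using fc by (auto simp: factor_code_def)
  obtain y k where y: "y \<in> Y" "\<And>x. x \<in> X \<Longrightarrow> agree k y (\<phi> x) \<Longrightarrow> occurs_at u x 0"
    using irreducible_map_cylinder[OF X fc irr u] by blast
  obtain z l where z: "z \<in> Y" "\<And>x. x \<in> X \<Longrightarrow> agree l z (\<phi> x) \<Longrightarrow> occurs_at v x 0"
    using irreducible_map_cylinder[OF X fc irr v] by blast
  let ?a = "word_at y (- int k) (2 * k + 1)" and ?b = "word_at z (- int l) (2 * l + 1)"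
  obtain g where g: "length u \<le> length g" "?a @ g @ ?b \<in> language Y"
    using irreducible_shift_gap[OF Y irrY word_at_in_language[OF y(1)] word_at_in_language[OF z(1)]] .
  obtain y' where y': "y' \<in> Y" "occurs_at (?a @ g @ ?b) y' (- int k)"
    using language_occurs_at[OF Y g(2)] .
  then obtain x where x: "x \<in> X" "\<phi> x = y'" using onto by blast
  \<comment> \<open>the distance between the centres of the two words in \<open>y'\<close>; the length of \<open>g\<close> keeps \<open>u\<close> and \<open>v\<close> disjoint\<close>
  define d where "d = int k + 1 + int (length g) + int l"
  have a: "occurs_at ?a y' (- int k)" and b: "occurs_at ?b (\<lambda>i. y' (i + d)) (- int l)"
    using y'(2) by (simp_all add: occurs_at_append occurs_at_translate d_def)
  have ux: "occurs_at u x 0"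
    using y(2)[OF x(1)] occurs_at_central_word[OF a] x(2) by simp
  have "occurs_at v (\<lambda>i. x (i + d)) 0"
    using z(2)[OF shift_space_translate[OF X x(1)]] occurs_at_central_word[OF b]
      code_translate[OF X c x(1)] x(2) by simp
  then have vx: "occurs_at v x d" by (simp add: occurs_at_translate)
  define w where "w = word_at x (int (length u)) (nat (d - int (length u)))"
  have "occurs_at (u @ w @ v) x 0"
    using ux vx g(1) by (simp add: occurs_at_append w_def d_def)
  then show "\<exists>w. u @ w @ v \<in> language X"
    using x(1) by (auto simp: language_def)
qed

section \<open>Counting words\<close>

lemma finite_blocks_split:
  fixes F :: "nat \<Rightarrow> 'a list set"
  assumes fin: "\<And>n. finite (F n)"
    and split: "\<And>w m n. w \<in> F (m + n) \<Longrightarrow> take m w \<in> F m \<and> drop m w \<in> F n"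
  shows "card (F (m + n)) \<le> card (F m) * card (F n)"
proof -
  have "inj_on (\<lambda>w. (take m w, drop m w)) (F (m + n))"
    by (rule inj_onI) (metis append_take_drop_id prod.inject)
  then have "card (F (m + n)) \<le> card (F m \<times> F n)"
    by (rule card_inj_on_le) (use fin split in auto)
  then show ?thesis by (simp add: card_cartesian_product)
qed

text \<open>
  A single value \<open>c m \<le> l\<^sup>m\<close> of a submultiplicative sequence bounds its exponential growth
  rate by \<open>l\<close>. The values need not be positive, since a shift space or a set of words avoiding a
  given word may have no long words at all.
\<close>

lemma submultiplicative_growth:
  fixes c :: "nat \<Rightarrow> nat" and l :: real
  assumes sub: "\<And>m n. c (m + n) \<le> c m * c n"
    and l: "0 < l" and m: "0 < m" and cm: "real (c m) \<le> l ^ m"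
  obtains C where "0 < C" "\<And>n. real (c n) \<le> C * l ^ n"
proof -
  define C where "C = 1 + (\<Sum>r<m. real (c r) / l ^ r)"
  have Cr: "real (c r) \<le> C * l ^ r" if "r < m" for r
  proof -
    have "real (c r) / l ^ r \<le> (\<Sum>r<m. real (c r) / l ^ r)"
      using l that by (intro member_le_sum) auto
    also have "\<dots> \<le> C" by (simp add: C_def)
    finally show ?thesis using l by (simp add: pos_divide_le_eq)
  qed
  have "0 < C"
    unfolding C_def using l by (intro add_pos_nonneg sum_nonneg) auto
  have step: "real (c n) \<le> C * l ^ n" for n
  proof (induction n rule: less_induct)
    case (less n)
    show ?case
    proof (cases "n < m")
      case False
      then have n: "m + (n - m) = n" by simp
      have "real (c n) \<le> real (c m) * real (c (n - m))"
        using sub[of m "n - m"] unfolding n by (metis of_nat_le_iff of_nat_mult)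
      also have "\<dots> \<le> l ^ m * (C * l ^ (n - m))"
        using less[of "n - m"] cm l m False by (intro mult_mono) auto
      also have "\<dots> = C * l ^ n"
        using n by (metis mult.left_commute power_add)
      finally show ?thesis .
    qed (use Cr in auto)
  qed
  show ?thesis using that \<open>0 < C\<close> step by blast
qed

lemma blocks_split:
  assumes "w \<in> blocks (m + n) X"
  shows "take m w \<in> blocks m X \<and> drop m w \<in> blocks n X"
proof -
  have w: "w \<in> language X" "length w = m + n" using assms by (auto simp: blocks_def)
  have "take m w \<in> language X" "drop m w \<in> language X"
    using w(1) language_infix[of "[]" "take m w" "drop m w" X]
      language_infix[of "take m w" "drop m w" "[]" X] by simp_all
  then show ?thesis using w(2) by (simp add: blocks_def)
qed

lemma card_blocks_submult:
  assumes "shift_space X"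
  shows "card (blocks (m + n) X) \<le> card (blocks m X) * card (blocks n X)"
  by (rule finite_blocks_split[of "\<lambda>n. blocks n X"]) (use assms finite_blocks blocks_split in blast)+

lemma card_blocks_pos:
  assumes "shift_space X" "X \<noteq> {}"
  shows "0 < card (blocks n X)"
proof -
  obtain x where "x \<in> X" using assms by blast
  then have "word_at x 0 n \<in> blocks n X"
    by (simp add: blocks_def word_at_in_language)
  then show ?thesis using finite_blocks[OF assms(1)] card_gt_0_iff by blast
qed

text \<open>
  Fekete's lemma for the number of blocks of a nonempty shift space: the limit in the definition of entropy exists and equals
  the infimum of the sequence. The infimum property gives the last claim, a lower bound for the
  number of blocks of every length.
\<close>

lemma entropy_limit:
  assumes X: "shift_space X" and ne: "X \<noteq> {}"
  obtains h where "entropy X = ereal h"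
    "(\<lambda>n. ln (real (card (blocks n X))) / real n) \<longlonglongrightarrow> h"
    "\<And>n. 0 < n \<Longrightarrow> exp h ^ n \<le> real (card (blocks n X))"
proof -
  define c where "c n = card (blocks n X)" for n
  have c1: "1 \<le> real (c n)" for n
    using card_blocks_pos[OF X ne, of n] by (simp add: c_def)
  define u where "u n = ln (real (c n)) / real n" for n
  define h where "h = Inf (u ` {0<..})"
  have bdd: "bdd_below (u ` {0<..})"
    by (rule bdd_belowI[of _ 0]) (use c1 in \<open>auto simp: u_def\<close>)
  have hu: "h \<le> u n" if "0 < n" for n
    unfolding h_def using bdd that by (intro cInf_lower) auto
  have lim: "u \<longlonglongrightarrow> h"
  proof (rule LIMSEQ_I)
    fix e :: real assume e: "0 < e"
    have "\<exists>v\<in>u ` {0<..}. v < h + e / 2"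
      unfolding h_def using e bdd by (intro cInf_lessD) (auto intro!: exI[of _ 1])
    then obtain m where m: "0 < m" "u m < h + e / 2" by auto
    define a where "a = h + e / 2"
    have "ln (real (c m)) \<le> a * real m"
      using m by (simp add: u_def a_def field_simps)
    then have "real (c m) \<le> exp (a * real m)"
      using c1[of m] by (metis exp_le_cancel_iff exp_ln less_le_trans zero_less_one)
    then have "real (c m) \<le> exp a ^ m"
      by (simp add: exp_of_nat2_mult)
    then obtain C where C: "0 < C" "\<And>n. real (c n) \<le> C * exp a ^ n"
      using submultiplicative_growth[of c "exp a" m] card_blocks_submult[OF X] m(1)
      by (auto simp: c_def)
    have up: "u n \<le> ln C / real n + a" if n: "0 < n" for n
    proof -
      have "ln (real (c n)) \<le> ln (C * exp a ^ n)"
        using C c1[of n] by (intro ln_mono) (auto intro: less_le_trans[OF zero_less_one])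
      also have "\<dots> = ln C + a * real n"
        using C(1) by (simp add: ln_mult ln_realpow)
      finally show ?thesis using n by (simp add: u_def field_simps)
    qed
    have "(\<lambda>n. ln C / real n) \<longlonglongrightarrow> 0"
      by (rule lim_const_over_n)
    then obtain N where N: "\<And>n. n \<ge> N \<Longrightarrow> \<bar>ln C / real n\<bar> < e / 2"
      using LIMSEQ_D[of "\<lambda>n. ln C / real n" 0 "e / 2"] e by auto
    have "norm (u n - h) < e" if n: "max 1 N \<le> n" for n
    proof -
      have "ln C / real n < e / 2" using N[of n] n by linarith
      moreover have "h \<le> u n" "u n \<le> ln C / real n + (h + e / 2)"
        using hu[of n] up[of n] n by (auto simp: a_def)
      ultimately show ?thesis unfolding real_norm_def by linarith
    qed
    then show "\<exists>no. \<forall>n\<ge>no. norm (u n - h) < e" by blast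
  qed
  have "(\<lambda>n. ereal (u n)) \<longlonglongrightarrow> ereal h" using lim by simp
  then have "entropy X = ereal h"
    using ne limI by (auto simp: entropy_def u_def c_def)
  moreover have "exp h ^ n \<le> real (card (blocks n X))" if n: "0 < n" for n
  proof -
    have "h * real n \<le> ln (real (c n))"
      using hu[OF n] n by (simp add: u_def field_simps)
    then have "exp (h * real n) \<le> real (c n)"
      using c1[of n] by (metis exp_le_cancel_iff exp_ln less_le_trans zero_less_one)
    then show ?thesis by (simp add: exp_of_nat2_mult c_def)
  qed
  ultimately show ?thesis using that lim by (simp add: u_def[abs_def] c_def)
qed

lemma small_entropy_block_count:
  assumes Z: "shift_space Z" and h: "entropy Z < ereal a"
  obtains m where "0 < m" "real (card (blocks m Z)) \<le> exp a ^ m"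
proof (cases "Z = {}")
  case True
  then have "blocks 1 Z = {}" by (simp add: blocks_def language_def)
  then show ?thesis using that[of 1] by simp
next
  case False
  obtain h where h': "entropy Z = ereal h"
    "(\<lambda>n. ln (real (card (blocks n Z))) / real n) \<longlonglongrightarrow> h"
    using entropy_limit[OF Z False] by blast
  have "h < a" using h h'(1) by simp
  then have "eventually (\<lambda>n. ln (real (card (blocks n Z))) / real n < a) sequentially"
    using order_tendstoD(2)[OF h'(2)] by blast
  then have "eventually (\<lambda>n. 0 < n \<and> ln (real (card (blocks n Z))) / real n < a) sequentially"
    using eventually_gt_at_top[of 0] by eventually_elim simp
  then obtain m where m: "0 < m" "ln (real (card (blocks m Z))) / real m < a"
    using eventually_happens[of _ "sequentially"] by (metis (mono_tags, lifting) sequentially_bot)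
  then have "ln (real (card (blocks m Z))) \<le> a * real m" by (simp add: field_simps)
  then have "real (card (blocks m Z)) \<le> exp (a * real m)"
    using card_blocks_pos[OF Z False, of m] by (metis exp_le_cancel_iff exp_ln of_nat_0_less_iff)
  then show ?thesis using that[OF m(1)] by (simp add: exp_of_nat2_mult)
qed

section \<open>Words avoiding a given word\<close>

text \<open>
  The subsystem of the points of \<open>X\<close> in which the word \<open>u\<close> never occurs.
\<close>

definition avoiding :: "(int \<Rightarrow> 'a) set \<Rightarrow> 'a list \<Rightarrow> (int \<Rightarrow> 'a) set" where
  "avoiding X u = {x \<in> X. \<forall>i. \<not> occurs_at u x i}"

lemma subsystem_avoiding:
  assumes X: "shift_space X"
  shows "subsystem (avoiding X u) X"
proof -
  have "openin config_topology {x. \<exists>i. occurs_at u x i}"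
    using openin_occurs_somewhere[of "\<lambda>_. True" u] by simp
  then have "closedin config_topology {x. \<forall>i. \<not> occurs_at u x i}"
    by (simp add: closedin_def Compl_eq_Diff_UNIV[symmetric] Collect_neg_eq[symmetric])
  moreover have "avoiding X u = X \<inter> {x. \<forall>i. \<not> occurs_at u x i}"
    by (auto simp: avoiding_def)
  ultimately have "closedin config_topology (avoiding X u)"
    using X by (simp add: shift_space_def closedin_Int)
  moreover have "shift ` avoiding X u = avoiding X u"
  proof
    show "shift ` avoiding X u \<subseteq> avoiding X u"
      using shift_space_translate[OF X, of _ 1]
      by (auto simp: avoiding_def shift_def occurs_at_translate)
    show "avoiding X u \<subseteq> shift ` avoiding X u"
    proof
      fix x assume "x \<in> avoiding X u"
      then have "(\<lambda>i. x (i + - 1)) \<in> avoiding X u"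
        using shift_space_translate[OF X, of x "- 1"]
        by (simp add: avoiding_def occurs_at_translate del: add_uminus_conv_diff)
      moreover have "shift (\<lambda>i. x (i + - 1)) = x" by (simp add: shift_def)
      ultimately show "x \<in> shift ` avoiding X u" by (metis imageI)
    qed
  qed
  moreover have "\<exists>A. finite A \<and> (\<forall>x\<in>avoiding X u. range x \<subseteq> A)"
  proof -
    obtain A where "finite A" "\<forall>x\<in>X. range x \<subseteq> A" using X unfolding shift_space_def by blast
    then show ?thesis unfolding avoiding_def by (intro exI[of _ A]) blast
  qed
  ultimately show ?thesis
    by (auto simp: subsystem_def shift_space_def avoiding_def)
qed

lemma avoiding_proper:
  assumes "u \<in> language X"
  shows "avoiding X u \<noteq> X"
proof -
  obtain x i where "x \<in> X" "occurs_at u x i"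
    using assms by (auto simp: language_def)
  then show ?thesis by (auto simp: avoiding_def)
qed

text \<open>
  The blocks of \<open>X\<close> that do not contain \<open>u\<close>. Unlike the blocks of the subsystem
  \<open>avoiding X u\<close>, they may occur only in points of \<open>X\<close> that contain \<open>u\<close> elsewhere.
\<close>

definition avoiding_blocks :: "(int \<Rightarrow> 'a) set \<Rightarrow> 'a list \<Rightarrow> nat \<Rightarrow> 'a list set" where
  "avoiding_blocks X u n = {w \<in> blocks n X. \<not> sublist u w}"

text \<open>
  The words that occur in the middle of a word of \<open>X\<close> without \<open>u\<close>, with at least \<open>N\<close>
  letters on either side. They interpolate between the previous set (\<open>N = 0\<close>) and the blocks of
  \<open>avoiding X u\<close>, which are reached at a finite \<open>N\<close> for each length
  (\<open>extendable_blocks_subset\<close>). Requiring at least, rather than exactly, \<open>N\<close> letters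
  makes it plain that prefixes and suffixes of such words are again such words, as needed for
  submultiplicativity.
\<close>

definition extendable_blocks :: "(int \<Rightarrow> 'a) set \<Rightarrow> 'a list \<Rightarrow> nat \<Rightarrow> nat \<Rightarrow> 'a list set" where
  "extendable_blocks X u N n = {w. length w = n \<and> (\<exists>p q. N \<le> length p \<and> N \<le> length q \<and>
     p @ w @ q \<in> language X \<and> \<not> sublist u (p @ w @ q))}"

lemma extendable_blocksI:
  assumes "length w = n" "N \<le> length p" "N \<le> length q"
    "p @ w @ q \<in> language X" "\<not> sublist u (p @ w @ q)"
  shows "w \<in> extendable_blocks X u N n"
  using assms by (auto simp: extendable_blocks_def)

lemma occurs_at_sublist:
  assumes "occurs_at w x i" "i \<le> j" "j + int (length u) \<le> i + int (length w)" "occurs_at u x j"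
  shows "sublist u w"
proof -
  define d where "d = nat (j - i)"
  have dl: "d + length u \<le> length w" using assms(2,3) by (simp add: d_def)
  have j: "j = i + int d" using assms(2) by (simp add: d_def)
  have "u = take (length u) (drop d w)"
  proof (rule nth_equalityI)
    show "length u = length (take (length u) (drop d w))" using dl by simp
    fix l assume l: "l < length u"
    have "x (i + int (d + l)) = w ! (d + l)"
      using assms(1) l dl unfolding occurs_at_iff by (meson add_strict_left_mono order_less_le_trans)
    moreover have "x (j + int l) = u ! l"
      using assms(4) l unfolding occurs_at_iff by auto
    ultimately show "u ! l = take (length u) (drop d w) ! l"
      using l dl by (simp add: j add.assoc)
  qed
  then show ?thesis by (metis sublist_take sublist_drop sublist_order.order_trans)
qed

text \<open>
  By compactness: otherwise there is a point of \<open>X\<close> without \<open>u\<close> whose block of length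
  \<open>m\<close> at the origin does not occur in \<open>avoiding X u\<close>.
\<close>

lemma extendable_blocks_subset:
  assumes X: "shift_space X"
  shows "\<exists>N. extendable_blocks X u N m \<subseteq> blocks m (avoiding X u)"
proof (rule ccontr)
  assume "\<nexists>N. extendable_blocks X u N m \<subseteq> blocks m (avoiding X u)"
  then have neg: "\<exists>w. w \<in> extendable_blocks X u N m \<and> w \<notin> blocks m (avoiding X u)" for N
    by blast
  define D where "D k = {x. word_at x 0 m \<notin> language (avoiding X u)} \<inter>
     {x. \<forall>i. \<bar>i\<bar> \<le> int k \<longrightarrow> \<not> occurs_at u x i}" for k
  have cl: "closedin config_topology (D k)" for k
    unfolding D_def
  proof (rule closedin_Int)
    show "closedin config_topology {x. word_at x 0 m \<notin> language (avoiding X u)}"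
    proof (rule closedin_config_window[of m])
      fix x z :: "int \<Rightarrow> 'a" assume "agree m x z"
      then have "word_at x 0 m = word_at z 0 m" by (auto simp: word_at_def agree_def)
      then show "word_at z 0 m \<notin> language (avoiding X u) \<Longrightarrow>
        word_at x 0 m \<notin> language (avoiding X u)" by simp
    qed
    have "openin config_topology {x. \<exists>i. \<bar>i\<bar> \<le> int k \<and> occurs_at u x i}"
      by (rule openin_occurs_somewhere)
    then show "closedin config_topology {x. \<forall>i. \<bar>i\<bar> \<le> int k \<longrightarrow> \<not> occurs_at u x i}"
      by (simp add: closedin_def Compl_eq_Diff_UNIV[symmetric] Collect_neg_eq[symmetric])
  qed
  have ne: "\<exists>x\<in>X. x \<in> D k" for k
  proof -
    obtain w where w: "w \<in> extendable_blocks X u (k + length u) m" "w \<notin> blocks m (avoiding X u)"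
      using neg by blast
    then obtain p q where pq: "length w = m" "k + length u \<le> length p" "k + length u \<le> length q"
      "p @ w @ q \<in> language X" "\<not> sublist u (p @ w @ q)"
      by (auto simp: extendable_blocks_def)
    obtain x where x: "x \<in> X" "occurs_at (p @ w @ q) x (- int (length p))"
      using language_occurs_at[OF X pq(4)] .
    have "occurs_at w x 0" using x(2) by (simp add: occurs_at_append)
    then have "word_at x 0 m = w" using pq(1) by (simp add: occurs_at_def)
    then have "word_at x 0 m \<notin> language (avoiding X u)" using w(2) pq(1) by (simp add: blocks_def)
    moreover have "\<not> occurs_at u x i" if "\<bar>i\<bar> \<le> int k" for i
      using occurs_at_sublist[OF x(2), of i u] pq(2,3,5) that by fastforce
    ultimately show ?thesis using x(1) by (auto simp: D_def)
  qed
  have dec: "D k \<subseteq> D j" if "j \<le> k" for j k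
    using that by (auto simp: D_def)
  obtain x where x: "x \<in> X" "\<And>k. x \<in> D k"
    using shift_space_nested_closed[of X D, OF X cl ne dec] by auto
  have "\<not> occurs_at u x i" for i
    using x(2)[of "nat \<bar>i\<bar>"] by (auto simp: D_def)
  then have "x \<in> avoiding X u" using x(1) by (simp add: avoiding_def)
  then show False
    using x(2)[of 0] word_at_in_language[of x "avoiding X u" 0 m] by (simp add: D_def)
qed

lemma extendable_blocks_split:
  assumes "w \<in> extendable_blocks X u N (m + n)"
  shows "take m w \<in> extendable_blocks X u N m \<and> drop m w \<in> extendable_blocks X u N n"
proof -
  obtain p q where pq: "length w = m + n" "N \<le> length p" "N \<le> length q"
    "p @ w @ q \<in> language X" "\<not> sublist u (p @ w @ q)"
    using assms by (auto simp: extendable_blocks_def)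
  have 1: "p @ take m w @ (drop m w @ q) = p @ w @ q"
    and 2: "(p @ take m w) @ drop m w @ q = p @ w @ q"
    by (metis append.assoc append_take_drop_id)+
  have "take m w \<in> extendable_blocks X u N m"
    by (rule extendable_blocksI[where p = p and q = "drop m w @ q"], unfold 1) (use pq in auto)
  moreover have "drop m w \<in> extendable_blocks X u N n"
    by (rule extendable_blocksI[where p = "p @ take m w" and q = q], unfold 2) (use pq in auto)
  ultimately show ?thesis ..
qed

lemma extendable_blocks_subset_blocks: "extendable_blocks X u N n \<subseteq> blocks n X"
  by (auto simp: extendable_blocks_def blocks_def intro: language_infix)

text \<open>
  The blocks of \<open>X\<close> that do not contain \<open>u\<close> grow no faster than the entropy of
  \<open>avoiding X u\<close> allows. Removing \<open>N\<close> letters at both ends, which changes the count by a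
  constant factor, leaves extendable words. For suitable \<open>m\<close> and \<open>N\<close>, those of length
  \<open>m\<close> are blocks of \<open>avoiding X u\<close> and so number at most \<open>exp (a m)\<close>, and
  submultiplicativity does the rest.
\<close>

lemma avoiding_blocks_growth:
  assumes X: "shift_space X" and h: "entropy (avoiding X u) < ereal a"
  shows "\<exists>C>0. \<forall>n. real (card (avoiding_blocks X u n)) \<le> C * exp a ^ n"
proof -
  have Z: "shift_space (avoiding X u)"
    using subsystem_avoiding[OF X, of u] by (simp add: subsystem_def)
  obtain m where m: "0 < m" "real (card (blocks m (avoiding X u))) \<le> exp a ^ m"
    using small_entropy_block_count[OF Z h] .
  obtain N where N: "extendable_blocks X u N m \<subseteq> blocks m (avoiding X u)"
    using extendable_blocks_subset[OF X] by blast
  let ?E = "extendable_blocks X u N"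
  have finE: "finite (?E n)" for n
    using extendable_blocks_subset_blocks finite_blocks[OF X] finite_subset by metis
  have "real (card (?E m)) \<le> exp a ^ m"
    using card_mono[OF finite_blocks[OF Z] N] m(2) by linarith
  moreover have "card (?E (i + j)) \<le> card (?E i) * card (?E j)" for i j
    by (rule finite_blocks_split[of ?E]) (use finE extendable_blocks_split in blast)+
  ultimately obtain C where C: "0 < C" "\<And>n. real (card (?E n)) \<le> C * exp a ^ n"
    using submultiplicative_growth[of "\<lambda>n. card (?E n)" "exp a" m] m(1) by auto
  let ?W = "avoiding_blocks X u" and ?K = "real (card (blocks N X))"
  have finW: "finite (?W n)" for n
    using finite_blocks[OF X] by (simp add: avoiding_blocks_def)
  have long: "real (card (?W (N + n + N))) \<le> ?K * (C * exp a ^ n) * ?K" for n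
  proof -
    let ?f = "\<lambda>w. (take N w, take n (drop N w), drop n (drop N w))"
    have "inj_on ?f (?W (N + n + N))"
      by (rule inj_onI) (metis append_take_drop_id prod.inject)
    moreover have "?f ` ?W (N + n + N) \<subseteq> blocks N X \<times> ?E n \<times> blocks N X"
    proof
      fix t assume "t \<in> ?f ` ?W (N + n + N)"
      then obtain w where w: "w \<in> ?W (N + n + N)" "t = ?f w" by blast
      then have wb: "w \<in> blocks (N + (n + N)) X" and wu: "\<not> sublist u w"
        by (simp_all add: avoiding_blocks_def add.assoc)
      have 1: "take N w \<in> blocks N X" and 2: "drop N w \<in> blocks (n + N) X"
        using blocks_split[OF wb] by auto
      have 3: "drop n (drop N w) \<in> blocks N X"
        using blocks_split[OF 2] by blast
      have eq: "take N w @ take n (drop N w) @ drop n (drop N w) = w"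
        by (simp only: append_take_drop_id)
      have "take n (drop N w) \<in> ?E n"
      proof (rule extendable_blocksI)
        show "take N w @ take n (drop N w) @ drop n (drop N w) \<in> language X"
          unfolding eq using wb by (simp add: blocks_def)
        show "\<not> sublist u (take N w @ take n (drop N w) @ drop n (drop N w))"
          unfolding eq by (rule wu)
      qed (use wb in \<open>auto simp: blocks_def\<close>)
      then show "t \<in> blocks N X \<times> ?E n \<times> blocks N X" using w(2) 1 3 by simp
    qed
    ultimately have "card (?W (N + n + N)) \<le> card (blocks N X \<times> ?E n \<times> blocks N X)"
      using finite_blocks[OF X] finE by (intro card_inj_on_le) auto
    then have "real (card (?W (N + n + N))) \<le> ?K * real (card (?E n)) * ?K"
      by (simp add: card_cartesian_product mult.assoc flip: of_nat_mult)
    also have "\<dots> \<le> ?K * (C * exp a ^ n) * ?K"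
      using C(2) by (intro mult_right_mono mult_left_mono) auto
    finally show ?thesis .
  qed
  \<comment> \<open>\<open>S\<close> takes care of the finitely many lengths too short for removing both ends\<close>
  define S where "S = (\<Sum>i<2 * N. real (card (?W i)) / exp a ^ i)"
  have S0: "0 \<le> S" unfolding S_def by (intro sum_nonneg) auto
  define C' where "C' = S + ?K * C * ?K / exp a ^ (2 * N) + 1"
  have K0: "0 \<le> ?K * C * ?K / exp a ^ (2 * N)" using C(1) by simp
  show ?thesis
  proof (intro exI[of _ C'] conjI allI)
    show "0 < C'" using S0 K0 by (simp add: C'_def)
    fix n
    show "real (card (?W n)) \<le> C' * exp a ^ n"
    proof (cases "n < 2 * N")
      case True
      then have "real (card (?W n)) / exp a ^ n \<le> S"
        unfolding S_def by (intro member_le_sum) auto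
      also have "\<dots> \<le> C'" using K0 by (simp add: C'_def)
      finally show ?thesis by (simp add: field_simps)
    next
      case False
      then have n: "N + (n - 2 * N) + N = n" by simp
      have "real (card (?W n)) \<le> ?K * (C * exp a ^ (n - 2 * N)) * ?K"
        using long[of "n - 2 * N"] unfolding n .
      also have "\<dots> = ?K * C * ?K / exp a ^ (2 * N) * exp a ^ n"
        using False by (simp add: power_diff)
      also have "\<dots> \<le> C' * exp a ^ n"
        using S0 by (intro mult_right_mono) (auto simp: C'_def)
      finally show ?thesis .
    qed
  qed
qed

section \<open>Entropy minimality\<close>

lemma first_occurrence_split:
  assumes "sublist u b" "u \<noteq> []"
  shows "\<exists>s c t. b = s @ c # t \<and> \<not> sublist u s \<and> sublist u (s @ [c])"
  using assms(1)
proof (induction b rule: rev_induct)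
  case Nil
  then show ?case using assms(2) by simp
next
  case (snoc x b)
  show ?case
  proof (cases "sublist u b")
    case True
    then obtain s c t where "b = s @ c # t" "\<not> sublist u s" "sublist u (s @ [c])"
      using snoc.IH by blast
    then show ?thesis by (intro exI[of _ s] exI[of _ c] exI[of _ "t @ [x]"]) simp
  next
    case False
    then show ?thesis using snoc.prems by blast
  qed
qed

text \<open>
  By counting blocks. The usual route is that an ergodic measure of maximal entropy has full
  support, as its support is a subsystem of full entropy.
\<close>

lemma entropy_minimal_imp_irreducible_shift:
  assumes X: "shift_space X"
    and min: "\<And>Z. subsystem Z X \<Longrightarrow> Z \<noteq> X \<Longrightarrow> entropy Z < entropy X"
  shows "irreducible_shift X"
  unfolding irreducible_shift_def
proof (intro ballI, rule ccontr)
  fix u v assume u: "u \<in> language X" and v: "v \<in> language X"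
    and "\<nexists>w. u @ w @ v \<in> language X"
  then have no: "u @ w @ v \<notin> language X" for w by blast
  have une: "u \<noteq> []" using no[of "[]"] v by auto
  have ne: "X \<noteq> {}" using u by (auto simp: language_def)
  obtain h where h: "entropy X = ereal h"
    "\<And>n. 0 < n \<Longrightarrow> exp h ^ n \<le> real (card (blocks n X))"
    using entropy_limit[OF X ne] by blast
  have "max (entropy (avoiding X u)) (entropy (avoiding X v)) < ereal h"
    using min[OF subsystem_avoiding[OF X] avoiding_proper] u v h(1) by simp
  then obtain a where a: "entropy (avoiding X u) < ereal a" "entropy (avoiding X v) < ereal a" "a < h"
    using ereal_dense2[of "max (entropy (avoiding X u)) (entropy (avoiding X v))" "ereal h"] by auto
  obtain C where C: "0 < C" "\<And>n. real (card (avoiding_blocks X u n)) \<le> C * exp a ^ n"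
    using avoiding_blocks_growth[OF X a(1)] by blast
  obtain D where D: "0 < D" "\<And>n. real (card (avoiding_blocks X v n)) \<le> D * exp a ^ n"
    using avoiding_blocks_growth[OF X a(2)] by blast
  let ?U = "avoiding_blocks X u" and ?V = "avoiding_blocks X v" and ?B = "\<lambda>n. blocks n X"
  have fin: "finite (?B n)" "finite (?U n)" "finite (?V n)" for n
    using finite_blocks[OF X] by (auto simp: avoiding_blocks_def)
  let ?glue = "\<lambda>(s, c, t). s @ c @ t"
  have cover: "?B (Suc n) \<subseteq> ?U (Suc n) \<union> (\<Union>j\<le>n. ?glue ` (?U j \<times> ?B 1 \<times> ?V (n - j)))" for n
  proof
    fix b assume b: "b \<in> ?B (Suc n)"
    show "b \<in> ?U (Suc n) \<union> (\<Union>j\<le>n. ?glue ` (?U j \<times> ?B 1 \<times> ?V (n - j)))"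
    proof (cases "sublist u b")
      case True
      then obtain s c t where sct: "b = s @ c # t" "\<not> sublist u s" "sublist u (s @ [c])"
        using first_occurrence_split une by blast
      have bl: "s @ [c] @ t \<in> language X" and len: "length s + length t = n"
        using b sct(1) by (auto simp: blocks_def)
      have parts: "s \<in> language X" "[c] \<in> language X" "t \<in> language X"
        using language_infix[of "[]" s "[c] @ t" X] language_infix[of s "[c]" t X]
          language_infix[of "s @ [c]" t "[]" X] bl by simp_all
      \<comment> \<open>\<open>s c\<close> contains \<open>u\<close>, so a \<open>v\<close> in \<open>t\<close> would give a word \<open>u w v\<close> of \<open>X\<close>\<close>
      have "\<not> sublist v t"
      proof
        assume "sublist v t"
        then obtain q r where t: "t = q @ v @ r" by (auto simp: sublist_def)
        obtain p q' where "s @ [c] = p @ u @ q'" using sct(3) by (auto simp: sublist_def)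
        then have "(s @ [c]) @ t = p @ (u @ (q' @ q) @ v) @ r" using t by simp
        then show False using bl no language_infix by (metis append.assoc)
      qed
      then have "(s, [c], t) \<in> ?U (length s) \<times> ?B 1 \<times> ?V (n - length s)"
        using parts sct(2) len by (auto simp: avoiding_blocks_def blocks_def)
      moreover have "b = ?glue (s, [c], t)" using sct(1) by simp
      moreover have "length s \<le> n" using len by simp
      ultimately show ?thesis by blast
    qed (use b in \<open>simp add: avoiding_blocks_def\<close>)
  qed
  define K where "K = real (card (?B 1))"
  have upper: "real (card (?B (Suc n))) \<le> (C * exp a + C * K * D) * (real n + 1) * exp a ^ n" for n
  proof -
    have part: "real (card (?glue ` (?U j \<times> ?B 1 \<times> ?V (n - j)))) \<le> C * K * D * exp a ^ n" if "j \<le> n" for j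
    proof -
      have "real (card (?glue ` (?U j \<times> ?B 1 \<times> ?V (n - j)))) \<le> real (card (?U j \<times> ?B 1 \<times> ?V (n - j)))"
        using fin by (intro of_nat_mono card_image_le) auto
      also have "\<dots> = real (card (?U j)) * (K * real (card (?V (n - j))))"
        by (simp add: card_cartesian_product K_def)
      also have "\<dots> \<le> (C * exp a ^ j) * (K * (D * exp a ^ (n - j)))"
        using C D by (intro mult_mono C(2) D(2)) (auto simp: K_def)
      also have "\<dots> = C * K * D * exp a ^ (j + (n - j))"
        by (simp only: power_add ac_simps)
      finally show ?thesis using that by simp
    qed
    have "card (?B (Suc n)) \<le> card (?U (Suc n)) + card (\<Union>j\<le>n. ?glue ` (?U j \<times> ?B 1 \<times> ?V (n - j)))"
      using fin by (intro order.trans[OF card_mono[OF _ cover] card_Un_le]) auto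
    also have "\<dots> \<le> card (?U (Suc n)) + (\<Sum>j\<le>n. card (?glue ` (?U j \<times> ?B 1 \<times> ?V (n - j))))"
      by (intro add_left_mono card_UN_le) simp
    finally have "real (card (?B (Suc n))) \<le>
        real (card (?U (Suc n))) + (\<Sum>j\<le>n. real (card (?glue ` (?U j \<times> ?B 1 \<times> ?V (n - j)))))"
      by (metis (no_types, lifting) of_nat_add of_nat_mono of_nat_sum sum.cong)
    also have "\<dots> \<le> C * exp a ^ Suc n + (\<Sum>j\<le>n. C * K * D * exp a ^ n)"
      by (intro add_mono C(2) sum_mono part) simp
    also have "\<dots> \<le> (C * exp a + C * K * D) * (real n + 1) * exp a ^ n"
      using C(1) by (simp add: algebra_simps)
    finally show ?thesis .
  qed
  \<comment> \<open>the two bounds on the number of blocks of length \<open>n + 1\<close> contradict each other for large \<open>n\<close>\<close>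
  define E where "E = C * exp a + C * K * D"
  define r where "r = exp (a - h)"
  have r: "0 < r" "r < 1" using a(3) by (simp_all add: r_def)
  have "exp h \<le> E * ((real n + 1) * r ^ n)" for n
  proof -
    have "exp h * exp h ^ n \<le> E * (real n + 1) * exp a ^ n"
      using h(2)[of "Suc n"] upper[of n] by (simp add: E_def)
    then have "exp h \<le> E * (real n + 1) * exp a ^ n / exp h ^ n"
      by (simp add: pos_le_divide_eq)
    also have "\<dots> = E * ((real n + 1) * r ^ n)"
      by (simp add: r_def exp_diff power_divide)
    finally show ?thesis .
  qed
  moreover have "(\<lambda>n. E * ((real n + 1) * r ^ n)) \<longlonglongrightarrow> 0"
  proof -
    have "norm r < 1" using r by simp
    then have "(\<lambda>n. real n * r ^ n) \<longlonglongrightarrow> 0" "(\<lambda>n. r ^ n) \<longlonglongrightarrow> 0"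
      using powser_times_n_limit_0[of r] LIMSEQ_power_zero[of r] by auto
    then have "(\<lambda>n. E * (real n * r ^ n + r ^ n)) \<longlonglongrightarrow> E * (0 + 0)"
      by (intro tendsto_mult_left tendsto_add)
    then show ?thesis by (simp add: algebra_simps)
  qed
  ultimately have "exp h \<le> 0"
    using LIMSEQ_le_const by blast
  then show False by simp
qed

section \<open>Bi-continuing codes\<close>

theorem corollary4p14:
  fixes X :: "(int \<Rightarrow> 'a) set" and Y :: "(int \<Rightarrow> 'b) set"
    and \<phi> :: "(int \<Rightarrow> 'a) \<Rightarrow> (int \<Rightarrow> 'b)"
  assumes "shift_space X"
    and "shift_of_finite_type Y"
    and "factor_code X Y \<phi>"
    and "finite_to_one X Y \<phi>"
    and "(\<forall>Z. subsystem Z X \<and> Z \<noteq> X \<longrightarrow> entropy Z < entropy X)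
         \<or> (irreducible_map X \<phi> \<and> irreducible_shift Y)"
    and "bi_continuing_ae X Y \<phi>"
    and "\<exists>n. bi_retract_ae X Y \<phi> n"
  shows "bi_continuing X Y \<phi> \<and> (\<exists>n. bi_retract X Y \<phi> n)"
proof -
  have "irreducible_shift X"
    using assms(5)
  proof
    assume "\<forall>Z. subsystem Z X \<and> Z \<noteq> X \<longrightarrow> entropy Z < entropy X"
    then show ?thesis
      by (intro entropy_minimal_imp_irreducible_shift[OF assms(1)]) blast
  next
    assume "irreducible_map X \<phi> \<and> irreducible_shift Y"
    then show ?thesis
      using irreducible_map_imp_irreducible_shift[OF assms(1) factor_shift_space[OF assms(1-3)] assms(3)]
      by blast
  qed
  then obtain n where n: "bi_retract X Y \<phi> n"
    using irreducible_domain_bi_retract[OF assms(1-3)] assms(7) by blast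
  then have "bi_continuing X Y \<phi>"
    using right_retract_imp_right_continuing[OF assms(1,3)]
      left_retract_imp_left_continuing[OF assms(1,3)]
    by (auto simp: bi_retract_def bi_continuing_def)
  then show ?thesis using n by blast
qed

end
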